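(* Let $(a_i)_{i\in\mathbb Z_{>0}}$ and $(b_j)_{j\in\mathbb Z_{>0}}$ be real sequences, with $\inf\mathbf a=\inf_i a_i$ and $\inf\mathbf b=\inf_j b_j$, such that $\inf\mathbf a+\inf\mathbf b>0$ and $$\mathrm M_z(\infty,\infty):=\sum_{i=1}^\infty\frac1{a_i+z}+\sum_{j=1}^\infty\frac1{b_j-z}<\infty\qquad\text{for } -\inf\mathbf a<z<\inf\mathbf b.$$ Define $$\mathcal M(\infty,\infty)=\inf_{-\inf\mathbf a<z<\inf\mathbf b}\mathrm M_z(\infty,\infty).$$ Let $\{\omega(i,j):i,j\in\mathbb Z_{>0}\}$ be i.i.d. $\mathrm{Exp}(1)$ random variables on a probability space with measure $\mathbf P$, and for $i,j,n\in\mathbb Z_{>0}$ set $$\omega_n(i,j)=\frac{\omega(i,j)}{a_{\lceil i/n\rceil}+b_{\lceil j/n\rceil}}.$$ For each $n\in\mathbb Z_{>0}$ let $\mathrm G_n(i,j)$, $i,j\in\mathbb Z_{>0}$, be the last-passage time from $(1,1)$ to $(i,j)$ with weights $\omega_n$. Then, $\mathbf P$-almost surely, $$\lim_{n\to\infty}n^{-1}\sup_{i,j\in\mathbb Z_{>0}}\mathrm G_n(i,j)=\mathcal M(\infty,\infty).$$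
   Context: $\mathrm{Exp}(1)$ is the exponential distribution with mean $1$. The last-passage time from $(1,1)$ to $(i,j)$ with weights $w$ is $\max_\pi\sum_{(k,l)\in\pi}w(k,l)$, the maximum over all up-right lattice paths $\pi$ from $(1,1)$ to $(i,j)$ (steps $(1,0)$ or $(0,1)$, both endpoints included). *)

theory Defs
  imports "HOL-Probability.Probability"
begin

text \<open>
  Sequences and arrays indexed by the positive integers are functions on \<^typ>\<open>nat\<close> that
  are only ever evaluated at arguments \<open>\<ge> 1\<close>; values at \<open>0\<close> are irrelevant.
\<close>

text \<open>The infimum is taken in the extended reals, so it is \<open>-\<infinity>\<close> for a sequence that is
  unbounded below; \<open>inf_seq a + inf_seq b > 0\<close> then forces both sequences to be bounded below.\<close>

definition inf_seq :: "(nat \<Rightarrow> real) \<Rightarrow> ereal" where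
  "inf_seq a = (INF i\<in>{1..}. ereal (a i))"

definition strip :: "(nat \<Rightarrow> real) \<Rightarrow> (nat \<Rightarrow> real) \<Rightarrow> real set" where
  "strip a b = {z. - inf_seq a < ereal z \<and> ereal z < inf_seq b}"

text \<open>Extended-real valued; for \<open>z \<in> strip a b\<close> all terms are positive, so both series have
  a value in \<open>[0, \<infinity>]\<close>. The summation index is shifted by \<open>Suc\<close> to start at \<open>1\<close>.\<close>

definition M_z :: "(nat \<Rightarrow> real) \<Rightarrow> (nat \<Rightarrow> real) \<Rightarrow> real \<Rightarrow> ereal" where
  "M_z a b z =
     (\<Sum>i. ereal (1 / (a (Suc i) + z))) + (\<Sum>j. ereal (1 / (b (Suc j) - z)))"

definition M_inf :: "(nat \<Rightarrow> real) \<Rightarrow> (nat \<Rightarrow> real) \<Rightarrow> ereal" where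
  "M_inf a b = (INF z\<in>strip a b. M_z a b z)"

definition up_right_step :: "nat \<times> nat \<Rightarrow> nat \<times> nat \<Rightarrow> bool" where
  "up_right_step p q \<longleftrightarrow> q = (fst p + 1, snd p) \<or> q = (fst p, snd p + 1)"

definition up_right_paths :: "nat \<times> nat \<Rightarrow> nat \<times> nat \<Rightarrow> (nat \<times> nat) list set" where
  "up_right_paths p q =
     {\<pi>. \<pi> \<noteq> [] \<and> hd \<pi> = p \<and> last \<pi> = q \<and> successively up_right_step \<pi>}"

definition last_passage :: "(nat \<Rightarrow> nat \<Rightarrow> real) \<Rightarrow> nat \<Rightarrow> nat \<Rightarrow> real" where
  "last_passage w i j =
     Max ((\<lambda>\<pi>. \<Sum>(k, l)\<leftarrow>\<pi>. w k l) ` up_right_paths (1, 1) (i, j))"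

definition scaled_weight ::
  "(nat \<Rightarrow> real) \<Rightarrow> (nat \<Rightarrow> real) \<Rightarrow> (nat \<Rightarrow> nat \<Rightarrow> real) \<Rightarrow> nat \<Rightarrow> nat \<Rightarrow> nat \<Rightarrow> real" where
  "scaled_weight a b w n i j =
     w i j / (a (nat \<lceil>real i / real n\<rceil>) + b (nat \<lceil>real j / real n\<rceil>))"

text \<open>The maximum in \<^const>\<open>last_passage\<close> is over a finite non-empty set.\<close>

lemma up_right_path_bounds:
  assumes "\<pi> \<noteq> []" "successively up_right_step \<pi>"
  shows "set \<pi> \<subseteq> {..fst (last \<pi>)} \<times> {..snd (last \<pi>)} \<and>
    length \<pi> + fst (hd \<pi>) + snd (hd \<pi>) = Suc (fst (last \<pi>) + snd (last \<pi>))"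
  using assms
proof (induction \<pi> rule: induct_list012)
  case (3 x y zs)
  then show ?case by (auto simp: up_right_step_def mem_Times_iff)
qed auto

lemma finite_up_right_paths: "finite (up_right_paths p q)"
proof (rule finite_subset)
  show "up_right_paths p q \<subseteq>
    {\<pi>. set \<pi> \<subseteq> {..fst q} \<times> {..snd q} \<and> length \<pi> \<le> Suc (fst q + snd q)}"
    using up_right_path_bounds by (fastforce simp: up_right_paths_def)
qed (auto intro: finite_lists_length_le)

lemma up_right_paths_extend:
  assumes "\<pi> \<in> up_right_paths p q" "up_right_step q r"
  shows "\<pi> @ [r] \<in> up_right_paths p r"
  using assms by (auto simp: up_right_paths_def successively_append_iff)

lemma up_right_paths_nonempty:
  assumes "i \<ge> 1" "j \<ge> 1"
  shows "up_right_paths (1, 1) (i, j) \<noteq> {}"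
proof -
  have row: "up_right_paths (1, 1) (i, 1) \<noteq> {}"
    using assms(1)
  proof (induction i rule: dec_induct)
    case base
    have "[(1, 1)] \<in> up_right_paths (1, 1) (1, 1)" by (simp add: up_right_paths_def)
    then show ?case by blast
  next
    case (step n)
    have "up_right_step (n, 1) (Suc n, 1)" by (simp add: up_right_step_def)
    with step up_right_paths_extend show ?case by blast
  qed
  show ?thesis
    using assms(2)
  proof (induction j rule: dec_induct)
    case base
    show ?case by (rule row)
  next
    case (step n)
    have "up_right_step (i, n) (i, Suc n)" by (simp add: up_right_step_def)
    with step up_right_paths_extend show ?case by blast
  qed
qed

end

theory Submission
  imports Defs
begin

text \<open>Both bounds compare the model with last-passage times that also collect weights on the two axes.
  For \<open>z\<close> in the strip let the axis weights be independent exponentials, with rate \<open>a i + z\<close> in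
  column \<open>i\<close> and rate \<open>b j - z\<close> in row \<open>j\<close>. Since the rates of the two axis weights add up to the
  rate \<open>a i + b j\<close> of the weight at \<open>(i, j)\<close>, this boundary model is stationary: passing from one
  column to the next, the increments of the last-passage time are again independent exponentials
  with the same rates (Burke's property). Hence the boundary last-passage time of a box is
  a sum of independent exponentials along the lower edge plus a sum of independent exponentials
  along the right edge (\<open>stationary_lpp_eq_sums\<close>), and for boxes of side \<open>n * k\<close> Chernoff's bound
  concentrates it around \<open>n\<close> times the truncation \<open>head_sum a b k z\<close> of \<open>M_z a b z\<close>, with errors
  exponentially small in \<open>n\<close>, uniformly in \<open>k\<close> (\<open>boundary_lpp_deviation\<close>).

  Upper bound. Axis weights only increase last-passage times, so for each \<open>z\<close> in the strip the
  supremum over all boxes is at most \<open>n * (M_z a b z + \<delta>)\<close> except with exponentially small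
  probability, and the Borel-Cantelli lemma applies (\<open>AE_bulk_upper\<close>).

  Lower bound. Fix \<open>k\<close> and let \<open>z\<close> minimize \<open>head_sum a b k\<close>. An optimal path of the boundary model
  leaves the axis after some number of steps. If it made at least \<open>\<epsilon> * n\<close> steps on the first
  axis, then replacing \<open>z\<close> by \<open>z - \<eta>\<close>, which enlarges the weights on that axis, would raise the
  boundary last-passage time by at least \<open>n\<close> times a quantity of order \<open>\<epsilon> * \<eta>\<close>. But it concentrates
  around \<open>n * head_sum a b k (z - \<eta>)\<close>, and this differs from \<open>n * head_sum a b k z\<close> by only
  \<open>n * o(\<eta>)\<close>, because \<open>z\<close> is a critical point. The second axis is excluded in the same way by
  \<open>z + \<eta>\<close>. So the path leaves the axes within \<open>\<epsilon> * n\<close> steps, where it has collected \<open>O(\<epsilon> * n)\<close>, and the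
  rest of its weight comes from the model without boundary (\<open>lpp_exit_bound\<close>, \<open>AE_bulk_lower\<close>).
  Finally, the minima of \<open>head_sum a b k\<close> increase to \<open>M_inf a b\<close> by a compactness argument
  (\<open>large_minimum\<close>).

  All of this takes place on one product space carrying the noise of the bulk and of the axes. The
  event in the theorem depends on the bulk only, whose law is determined by independence, which
  transfers the result to an arbitrary probability space.\<close>

section \<open>Last-passage times with boundary weights\<close>

text \<open>The axes \<open>i = 0\<close> and \<open>j = 0\<close> carry boundary weights. The recursion replaces the maximum over paths:
  it is monotone and commutes with adding constants, which is what the comparisons below use.\<close>

fun lpp :: "(nat \<Rightarrow> nat \<Rightarrow> real) \<Rightarrow> nat \<Rightarrow> nat \<Rightarrow> real" where
  "lpp w 0 0 = 0"
| "lpp w (Suc i) 0 = lpp w i 0 + w (Suc i) 0"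
| "lpp w 0 (Suc j) = lpp w 0 j + w 0 (Suc j)"
| "lpp w (Suc i) (Suc j) = w (Suc i) (Suc j) + max (lpp w i (Suc j)) (lpp w (Suc i) j)"

definition off_axes :: "(nat \<Rightarrow> nat \<Rightarrow> real) \<Rightarrow> nat \<Rightarrow> nat \<Rightarrow> real" where
  "off_axes w i j = (if i = 0 \<or> j = 0 then 0 else w i j)"

lemma off_axes_simps [simp]:
  "off_axes w i 0 = 0" "off_axes w 0 j = 0" "off_axes w (Suc i) (Suc j) = w (Suc i) (Suc j)"
  by (simp_all add: off_axes_def)

lemma lpp_first_axis: "lpp w i 0 = (\<Sum>p=1..i. w p 0)"
  by (induction i) auto

lemma lpp_second_axis: "lpp w 0 j = (\<Sum>p=1..j. w 0 p)"
  by (induction j) auto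

lemma lpp_mono_weights:
  assumes "\<And>i j. w i j \<le> w' i j"
  shows "lpp w i j \<le> lpp w' i j"
  using assms by (induction w i j rule: lpp.induct) (auto intro!: add_mono max.mono)

lemma lpp_nonneg:
  assumes "\<And>i j. 0 \<le> w i j"
  shows "0 \<le> lpp w i j"
  using assms by (induction w i j rule: lpp.induct) (auto simp: le_max_iff_disj)

lemma lpp_mono:
  assumes "\<And>i j. 0 \<le> w i j" "i \<le> i'" "j \<le> j'"
  shows "lpp w i j \<le> lpp w i' j'"
proof -
  have "lpp w p q \<le> lpp w (Suc p) q" for p q
    using assms(1)[of "Suc p" q] by (cases q) (auto intro: add_increasing)
  moreover have "lpp w p q \<le> lpp w p (Suc q)" for p q
    using assms(1)[of p "Suc q"] by (cases p) (auto intro: add_increasing)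
  ultimately show ?thesis
    using lift_Suc_mono_le[of "\<lambda>i. lpp w i j"] lift_Suc_mono_le[of "\<lambda>j. lpp w i' j"] assms(2,3)
    by (meson order_trans)
qed

lemma path_weight_le_lpp:
  assumes "\<pi> \<noteq> []" "hd \<pi> = (1, 1)" "successively up_right_step \<pi>"
  shows "(\<Sum>(k, l)\<leftarrow>\<pi>. w k l) \<le> lpp (off_axes w) (fst (last \<pi>)) (snd (last \<pi>)) \<and>
    1 \<le> fst (last \<pi>) \<and> 1 \<le> snd (last \<pi>)"
  using assms
proof (induction \<pi> rule: rev_induct)
  case (snoc x xs)
  show ?case
  proof (cases "xs = []")
    case True
    with snoc show ?thesis by (simp add: off_axes_def)
  next
    case False
    with snoc.prems have "successively up_right_step xs" "up_right_step (last xs) x" "hd xs = (1, 1)"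
      by (auto simp: successively_append_iff)
    moreover obtain p q where pq: "last xs = (p, q)" by fastforce
    ultimately have IH: "(\<Sum>(k, l)\<leftarrow>xs. w k l) \<le> lpp (off_axes w) p q" "1 \<le> p" "1 \<le> q"
      and x: "x = (Suc p, q) \<or> x = (p, Suc q)"
      using snoc.IH False by (auto simp: up_right_step_def)
    obtain p' q' where "p = Suc p'" "q = Suc q'"
      using IH by (metis Suc_le_D One_nat_def)
    with IH x show ?thesis by auto
  qed
qed simp

lemma lpp_le_path_weight:
  assumes w: "\<And>i j. 1 \<le> i \<Longrightarrow> 1 \<le> j \<Longrightarrow> 0 \<le> w i j"
  shows "\<exists>\<pi>\<in>up_right_paths (1, 1) (Suc i, Suc j).
    lpp (off_axes w) (Suc i) (Suc j) \<le> (\<Sum>(k, l)\<leftarrow>\<pi>. w k l)"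
proof (induction "i + j" arbitrary: i j rule: less_induct)
  case less
  have axis: "lpp (off_axes w) p 0 = 0" "lpp (off_axes w) 0 p = 0" for p
    by (simp_all add: lpp_first_axis lpp_second_axis off_axes_def)
  have nonneg: "0 \<le> lpp (off_axes w) p q" for p q
    by (rule lpp_nonneg) (simp add: off_axes_def w)
  have step: "\<exists>\<pi>\<in>up_right_paths (1, 1) (Suc i, Suc j).
      w (Suc i) (Suc j) + lpp (off_axes w) (Suc p) (Suc q) \<le> (\<Sum>(k, l)\<leftarrow>\<pi>. w k l)"
    if pq: "p + q < i + j" "up_right_step (Suc p, Suc q) (Suc i, Suc j)" for p q
  proof -
    obtain \<pi> where "\<pi> \<in> up_right_paths (1, 1) (Suc p, Suc q)"
      "lpp (off_axes w) (Suc p) (Suc q) \<le> (\<Sum>(k, l)\<leftarrow>\<pi>. w k l)"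
      using less[OF pq(1)] by blast
    then show ?thesis
      using up_right_paths_extend[OF _ pq(2)] by (intro bexI[of _ "\<pi> @ [(Suc i, Suc j)]"]) auto
  qed
  consider "i = 0" "j = 0" | i' where "i = Suc i'" "lpp (off_axes w) (Suc i) j \<le> lpp (off_axes w) i (Suc j)"
    | j' where "j = Suc j'" "lpp (off_axes w) i (Suc j) \<le> lpp (off_axes w) (Suc i) j"
    using nonneg axis by (cases i; cases j) (metis linear)+
  then show ?case
  proof cases
    case 1
    have "[(1, 1)] \<in> up_right_paths (1, 1) (Suc 0, Suc 0)"
      by (simp add: up_right_paths_def)
    with 1 show ?thesis
      by (intro bexI[of _ "[(1, 1)]"]) (auto simp: off_axes_def)
  next
    case (2 i')
    then show ?thesis using step[of i' j] by (auto simp: up_right_step_def off_axes_def max_def)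
  next
    case (3 j')
    then show ?thesis using step[of i j'] by (auto simp: up_right_step_def off_axes_def max_def)
  qed
qed

text \<open>With nonnegative weights, a path that starts at the origin and gains nothing on the axes does best
  by entering the bulk at \<open>(1, 1)\<close>.\<close>

lemma last_passage_eq_lpp:
  assumes "\<And>i j. 1 \<le> i \<Longrightarrow> 1 \<le> j \<Longrightarrow> 0 \<le> w i j" "1 \<le> i" "1 \<le> j"
  shows "last_passage w i j = lpp (off_axes w) i j"
  unfolding last_passage_def
proof (rule antisym)
  let ?f = "\<lambda>\<pi>. \<Sum>(k, l)\<leftarrow>\<pi>. w k l"
  have fin: "finite (?f ` up_right_paths (1, 1) (i, j))"
    by (simp add: finite_up_right_paths)
  show "Max (?f ` up_right_paths (1, 1) (i, j)) \<le> lpp (off_axes w) i j"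
  proof (subst Max_le_iff[OF fin])
    show "?f ` up_right_paths (1, 1) (i, j) \<noteq> {}"
      using up_right_paths_nonempty[OF assms(2,3)] by simp
    show "\<forall>x\<in>?f ` up_right_paths (1, 1) (i, j). x \<le> lpp (off_axes w) i j"
    proof
      fix x assume "x \<in> ?f ` up_right_paths (1, 1) (i, j)"
      then obtain \<pi> where "\<pi> \<noteq> []" "hd \<pi> = (1, 1)" "successively up_right_step \<pi>"
        "last \<pi> = (i, j)" "x = ?f \<pi>"
        by (auto simp: up_right_paths_def)
      then show "x \<le> lpp (off_axes w) i j"
        using path_weight_le_lpp[of \<pi> w] by simp
    qed
  qed
  obtain i' j' where "i = Suc i'" "j = Suc j'"
    using assms(2,3) by (metis Suc_le_D One_nat_def)
  then obtain \<pi> where "\<pi> \<in> up_right_paths (1, 1) (i, j)" "lpp (off_axes w) i j \<le> ?f \<pi>"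
    using lpp_le_path_weight[of w i' j', OF assms(1)] by auto
  then show "lpp (off_axes w) i j \<le> Max (?f ` up_right_paths (1, 1) (i, j))"
    using fin by (meson Max_ge imageI order_trans)
qed

text \<open>Three cases for the point where an optimal path leaves the axes. If it leaves within \<open>K\<close> steps, it
  collects at most the first \<open>K\<close> weights of both axes. If it makes more than \<open>K\<close> steps on the first
  axis, the same path collects under \<open>w'\<close> at least the excess of \<open>w'\<close> over \<open>w\<close> on the first \<open>K\<close> steps
  in addition; likewise for the second axis and \<open>w''\<close>. No path has to be mentioned: each
  of the four last-passage times satisfies the same recursion in the bulk up to an additive constant, so it
  suffices to check the axes.\<close>

lemma lpp_exit_bound:
  assumes bulk: "\<And>i j. w' (Suc i) (Suc j) = w (Suc i) (Suc j)" "\<And>i j. w'' (Suc i) (Suc j) = w (Suc i) (Suc j)"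
    and nonneg: "\<And>i. 0 \<le> w i 0" "\<And>j. 0 \<le> w 0 j"
    and up: "\<And>i. 1 \<le> i \<Longrightarrow> w i 0 \<le> w' i 0" "\<And>j. 1 \<le> j \<Longrightarrow> w 0 j \<le> w'' 0 j"
  shows "lpp w i j \<le> max ((\<Sum>p=1..K. w p 0) + (\<Sum>p=1..K. w 0 p) + lpp (off_axes w) i j)
    (max (lpp w' i j - (\<Sum>p=1..K. w' p 0 - w p 0)) (lpp w'' i j - (\<Sum>p=1..K. w'' 0 p - w 0 p)))"
    (is "_ \<le> max (?S + ?T + _) (max (_ - ?D) (_ - ?E))")
proof -
  have axis: "(\<Sum>p=1..i. f p) \<le> (\<Sum>p=1..K. f p) \<or> (\<Sum>p=1..i. f p) \<le> (\<Sum>p=1..i. g p) - (\<Sum>p=1..K. g p - f p)"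
    if "\<And>p. 0 \<le> f p" "\<And>p. 1 \<le> p \<Longrightarrow> f p \<le> g p" for i and f g :: "nat \<Rightarrow> real"
  proof (cases "i \<le> K")
    case True
    then show ?thesis using that by (intro disjI1 sum_mono2) auto
  next
    case False
    then have "{1..i} = {1..K} \<union> {Suc K..i}" by auto
    then have *: "(\<Sum>p=1..i. h p) = (\<Sum>p=1..K. h p) + (\<Sum>p=Suc K..i. h p)" for h :: "nat \<Rightarrow> real"
      by (simp add: sum.union_disjoint)
    have "(\<Sum>p=Suc K..i. f p) \<le> (\<Sum>p=Suc K..i. g p)" using that by (intro sum_mono) auto
    then show ?thesis unfolding *[of f] *[of g] by (simp add: sum_subtractf)
  qed
  have S: "0 \<le> ?S" "0 \<le> ?T" by (auto intro!: sum_nonneg nonneg)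
  have int0: "lpp (off_axes w) i 0 = 0" "lpp (off_axes w) 0 j = 0" for i j
    by (simp_all add: lpp_first_axis lpp_second_axis off_axes_def)
  have first: "lpp w i 0 \<le> max (?S + ?T + lpp (off_axes w) i 0) (max (lpp w' i 0 - ?D) (lpp w'' i 0 - ?E))" for i
    using axis[of "\<lambda>p. w p 0" "\<lambda>p. w' p 0" i, OF nonneg(1) up(1)] S
    unfolding lpp_first_axis[of w] lpp_first_axis[of w'] int0 by linarith
  have second: "lpp w 0 j \<le> max (?S + ?T + lpp (off_axes w) 0 j) (max (lpp w' 0 j - ?D) (lpp w'' 0 j - ?E))" for j
    using axis[of "\<lambda>p. w 0 p" "\<lambda>p. w'' 0 p" j, OF nonneg(2) up(2)] S
    unfolding lpp_second_axis[of w] lpp_second_axis[of w''] int0 by linarith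
  have "\<forall>i j. i + j \<le> n \<longrightarrow> lpp w i j \<le> max (?S + ?T + lpp (off_axes w) i j) (max (lpp w' i j - ?D) (lpp w'' i j - ?E))" for n
  proof (induction n)
    case (Suc n)
    show ?case
    proof (intro allI impI)
      fix i j assume ij: "i + j \<le> Suc n"
      show "lpp w i j \<le> max (?S + ?T + lpp (off_axes w) i j) (max (lpp w' i j - ?D) (lpp w'' i j - ?E))"
      proof (cases "i = 0 \<or> j = 0")
        case False
        then obtain p q where pq: "i = Suc p" "j = Suc q" by (metis not0_implies_Suc)
        have IH: "lpp w p j \<le> max (?S + ?T + lpp (off_axes w) p j) (max (lpp w' p j - ?D) (lpp w'' p j - ?E))"
          "lpp w i q \<le> max (?S + ?T + lpp (off_axes w) i q) (max (lpp w' i q - ?D) (lpp w'' i q - ?E))"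
          using ij pq Suc by simp_all
        have shift: "v + x \<le> max (s + (v + g')) (max (v + b' - d) (v + c' - e))"
          if "x \<le> max (s + g) (max (b - d) (c - e))" "g \<le> g'" "b \<le> b'" "c \<le> c'"
          for v x s g g' b b' c c' d e :: real
          using that by (auto simp: le_max_iff_disj)
        have rec: "lpp w i j = w i j + max (lpp w p j) (lpp w i q)"
          "lpp (off_axes w) i j = w i j + max (lpp (off_axes w) p j) (lpp (off_axes w) i q)"
          "lpp w' i j = w i j + max (lpp w' p j) (lpp w' i q)"
          "lpp w'' i j = w i j + max (lpp w'' p j) (lpp w'' i q)"
          using pq bulk by simp_all
        show ?thesis
          unfolding rec max_add_distrib_right[of "w i j" "lpp w p j"]
          by (intro max.boundedI shift[OF IH(1)] shift[OF IH(2)] max.cobounded1 max.cobounded2)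
      qed (use first second in blast)
    qed
  qed (use first[of 0] in simp)
  then show ?thesis by blast
qed

section \<open>Burke's property\<close>

abbreviation exp_distr :: "real \<Rightarrow> real measure" where
  "exp_distr r \<equiv> density lborel (exponential_density r)"

text \<open>One standard exponential variable for each lattice point: \<open>(i, 0)\<close> and \<open>(0, j)\<close> drive the boundary
  weights, the other points the bulk. Weights of any rate are quotients of these variables, which
  couples the boundary models for different parameters \<open>z\<close>.\<close>

definition noise :: "(nat \<times> nat \<Rightarrow> real) measure" where
  "noise = (\<Pi>\<^sub>M _\<in>UNIV. exp_distr 1)"

lemma prob_space_noise: "prob_space noise"
  unfolding noise_def by (intro prob_space_PiM prob_space_exponential_density) simp

lemma sets_noise: "sets noise = sets (\<Pi>\<^sub>M _\<in>UNIV. borel)"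
  unfolding noise_def by (intro sets_PiM_cong) auto

lemma space_noise [simp]: "space noise = UNIV"
  by (simp add: noise_def space_PiM)

lemma measurable_noise_component [measurable]: "(\<lambda>s. s e) \<in> borel_measurable noise"
  unfolding measurable_cong_sets[OF sets_noise refl] by measurable

lemma borel_measurable_triple:
  assumes f: "(\<lambda>(x, y, w). f x y w) \<in> borel_measurable (borel \<Otimes>\<^sub>M borel \<Otimes>\<^sub>M borel)"
    and [measurable]: "g \<in> borel_measurable N" "h \<in> borel_measurable N" "k \<in> borel_measurable N"
  shows "(\<lambda>p. f (g p) (h p) (k p)) \<in> borel_measurable N"
proof -
  have "(\<lambda>p. (g p, h p, k p)) \<in> N \<rightarrow>\<^sub>M borel \<Otimes>\<^sub>M borel \<Otimes>\<^sub>M borel" by measurable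
  from measurable_compose[OF this f] show ?thesis by simp
qed

lemma nn_integral_lborel_rotate:
  fixes f :: "real \<Rightarrow> real \<Rightarrow> real \<Rightarrow> ennreal"
  assumes f: "(\<lambda>(x, y, w). f x y w) \<in> borel_measurable (borel \<Otimes>\<^sub>M borel \<Otimes>\<^sub>M borel)"
  shows "(\<integral>\<^sup>+x. \<integral>\<^sup>+y. \<integral>\<^sup>+w. f x y w \<partial>lborel \<partial>lborel \<partial>lborel) =
    (\<integral>\<^sup>+y. \<integral>\<^sup>+w. \<integral>\<^sup>+x. f x y w \<partial>lborel \<partial>lborel \<partial>lborel)"
proof -
  note [measurable (raw)] = borel_measurable_triple[OF f]
  have "(\<integral>\<^sup>+x. \<integral>\<^sup>+y. \<integral>\<^sup>+w. f x y w \<partial>lborel \<partial>lborel \<partial>lborel) =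
    (\<integral>\<^sup>+y. \<integral>\<^sup>+x. \<integral>\<^sup>+w. f x y w \<partial>lborel \<partial>lborel \<partial>lborel)"
    by (intro lborel_pair.Fubini') measurable
  also have "\<dots> = (\<integral>\<^sup>+y. \<integral>\<^sup>+w. \<integral>\<^sup>+x. f x y w \<partial>lborel \<partial>lborel \<partial>lborel)"
    by (intro nn_integral_cong lborel_pair.Fubini') measurable
  finally show ?thesis .
qed

lemma nn_integral_lborel_shift:
  fixes f :: "real \<Rightarrow> ennreal"
  assumes "f \<in> borel_measurable borel"
  shows "(\<integral>\<^sup>+x. f (t + x) \<partial>lborel) = (\<integral>\<^sup>+x. f x \<partial>lborel)"
  using nn_integral_real_affine[OF assms, of 1 t] by simp

text \<open>The map sending \<open>(x, y, w)\<close> to \<open>(w + max 0 (x - y), w + max 0 (y - x), min x y)\<close> is a piecewise linear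
  involution of determinant \<open>\<pm>1\<close>. Concretely, on each of the regions \<open>y \<le> x\<close> and \<open>x < y\<close> it is a
  translation of one variable followed by a permutation of the variables.\<close>

lemma nn_integral_lborel_flip:
  fixes f :: "real \<Rightarrow> real \<Rightarrow> real \<Rightarrow> ennreal"
  assumes f: "(\<lambda>(x, y, w). f x y w) \<in> borel_measurable (borel \<Otimes>\<^sub>M borel \<Otimes>\<^sub>M borel)"
  shows "(\<integral>\<^sup>+x. \<integral>\<^sup>+y. \<integral>\<^sup>+w. f (w + max 0 (x - y)) (w + max 0 (y - x)) (min x y) \<partial>lborel \<partial>lborel \<partial>lborel) =
    (\<integral>\<^sup>+x. \<integral>\<^sup>+y. \<integral>\<^sup>+w. f x y w \<partial>lborel \<partial>lborel \<partial>lborel)"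
    (is "?L = ?R")
proof -
  note [measurable (raw)] = borel_measurable_triple[OF f]
  define g1 where "g1 x y w = (if y \<le> x then f x y w else 0)" for x y w
  define g2 where "g2 x y w = (if x < y then f x y w else 0)" for x y w
  have g1: "(\<lambda>(x, y, w). g1 x y w) \<in> borel_measurable (borel \<Otimes>\<^sub>M borel \<Otimes>\<^sub>M borel)"
    and g2: "(\<lambda>(x, y, w). g2 x y w) \<in> borel_measurable (borel \<Otimes>\<^sub>M borel \<Otimes>\<^sub>M borel)"
    unfolding g1_def g2_def by measurable
  note [measurable (raw)] = borel_measurable_triple[OF g1] borel_measurable_triple[OF g2]
  have split: "f x y w = g1 x y w + g2 x y w" for x y w
    by (simp add: g1_def g2_def)
  have "?L = (\<integral>\<^sup>+x. \<integral>\<^sup>+y. \<integral>\<^sup>+w. (g1 ((w - y) + x) w y + g2 w ((w - x) + y) x) \<partial>lborel \<partial>lborel \<partial>lborel)"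
    by (intro nn_integral_cong) (auto simp: g1_def g2_def max_def min_def algebra_simps)
  also have "\<dots> = (\<integral>\<^sup>+x. \<integral>\<^sup>+y. \<integral>\<^sup>+w. g1 ((w - y) + x) w y \<partial>lborel \<partial>lborel \<partial>lborel) +
      (\<integral>\<^sup>+x. \<integral>\<^sup>+y. \<integral>\<^sup>+w. g2 w ((w - x) + y) x \<partial>lborel \<partial>lborel \<partial>lborel)"
    by (simp add: nn_integral_add)
  also have "(\<integral>\<^sup>+x. \<integral>\<^sup>+y. \<integral>\<^sup>+w. g1 ((w - y) + x) w y \<partial>lborel \<partial>lborel \<partial>lborel) =
      (\<integral>\<^sup>+y. \<integral>\<^sup>+w. \<integral>\<^sup>+x. g1 ((w - y) + x) w y \<partial>lborel \<partial>lborel \<partial>lborel)"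
    by (rule nn_integral_lborel_rotate) measurable
  also have "\<dots> = (\<integral>\<^sup>+y. \<integral>\<^sup>+w. \<integral>\<^sup>+x. g1 x w y \<partial>lborel \<partial>lborel \<partial>lborel)"
    by (intro nn_integral_cong nn_integral_lborel_shift) measurable
  also have "\<dots> = (\<integral>\<^sup>+w. \<integral>\<^sup>+x. \<integral>\<^sup>+y. g1 x w y \<partial>lborel \<partial>lborel \<partial>lborel)"
    by (rule nn_integral_lborel_rotate) measurable
  also have "\<dots> = (\<integral>\<^sup>+x. \<integral>\<^sup>+w. \<integral>\<^sup>+y. g1 x w y \<partial>lborel \<partial>lborel \<partial>lborel)"
    by (rule lborel_pair.Fubini') measurable
  also have "(\<integral>\<^sup>+x. \<integral>\<^sup>+y. \<integral>\<^sup>+w. g2 w ((w - x) + y) x \<partial>lborel \<partial>lborel \<partial>lborel) =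
      (\<integral>\<^sup>+x. \<integral>\<^sup>+w. \<integral>\<^sup>+y. g2 w ((w - x) + y) x \<partial>lborel \<partial>lborel \<partial>lborel)"
    by (intro nn_integral_cong lborel_pair.Fubini') measurable
  also have "\<dots> = (\<integral>\<^sup>+x. \<integral>\<^sup>+w. \<integral>\<^sup>+y. g2 w y x \<partial>lborel \<partial>lborel \<partial>lborel)"
    by (intro nn_integral_cong nn_integral_lborel_shift) measurable
  also have "\<dots> = (\<integral>\<^sup>+w. \<integral>\<^sup>+y. \<integral>\<^sup>+x. g2 w y x \<partial>lborel \<partial>lborel \<partial>lborel)"
    by (rule nn_integral_lborel_rotate) measurable
  also have "(\<integral>\<^sup>+x. \<integral>\<^sup>+w. \<integral>\<^sup>+y. g1 x w y \<partial>lborel \<partial>lborel \<partial>lborel) + \<dots> = ?R"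
    unfolding split by (simp add: nn_integral_add)
  finally show ?thesis .
qed

text \<open>Burke's property at a single corner. The involution maps the octant onto itself and preserves
  \<open>\<alpha> * x + \<beta> * y + (\<alpha> + \<beta>) * w\<close>, hence also the joint density of the three exponentials; this is where
  the rate of \<open>w\<close> has to be the sum of the other two.\<close>

lemma nn_integral_exp_flip:
  fixes f :: "real \<Rightarrow> real \<Rightarrow> real \<Rightarrow> ennreal"
  assumes f: "(\<lambda>(x, y, w). f x y w) \<in> borel_measurable (borel \<Otimes>\<^sub>M borel \<Otimes>\<^sub>M borel)"
    and pos: "0 < \<alpha>" "0 < \<beta>"
  shows "(\<integral>\<^sup>+x. \<integral>\<^sup>+y. \<integral>\<^sup>+w. f (w + max 0 (x - y)) (w + max 0 (y - x)) (min x y)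
      \<partial>exp_distr (\<alpha> + \<beta>) \<partial>exp_distr \<beta> \<partial>exp_distr \<alpha>) =
    (\<integral>\<^sup>+x. \<integral>\<^sup>+y. \<integral>\<^sup>+w. f x y w \<partial>exp_distr (\<alpha> + \<beta>) \<partial>exp_distr \<beta> \<partial>exp_distr \<alpha>)"
    (is "?L = ?R")
proof -
  note [measurable (raw)] = borel_measurable_triple[OF f]
  define D where "D x y w = ennreal (exponential_density \<alpha> x) *
    (ennreal (exponential_density \<beta> y) * ennreal (exponential_density (\<alpha> + \<beta>) w))" for x y w
  have meas_D: "(\<lambda>(x, y, w). D x y w) \<in> borel_measurable (borel \<Otimes>\<^sub>M borel \<Otimes>\<^sub>M borel)"
    unfolding D_def by measurable
  note [measurable (raw)] = borel_measurable_triple[OF meas_D]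
  interpret Ea: prob_space "exp_distr \<alpha>" using pos by (intro prob_space_exponential_density)
  interpret Eb: prob_space "exp_distr \<beta>" using pos by (intro prob_space_exponential_density)
  interpret Eab: prob_space "exp_distr (\<alpha> + \<beta>)" using pos by (intro prob_space_exponential_density) simp
  have expand: "(\<integral>\<^sup>+x. \<integral>\<^sup>+y. \<integral>\<^sup>+w. h x y w \<partial>exp_distr (\<alpha> + \<beta>) \<partial>exp_distr \<beta> \<partial>exp_distr \<alpha>) =
    (\<integral>\<^sup>+x. \<integral>\<^sup>+y. \<integral>\<^sup>+w. D x y w * h x y w \<partial>lborel \<partial>lborel \<partial>lborel)"
    if h: "(\<lambda>(x, y, w). h x y w) \<in> borel_measurable (borel \<Otimes>\<^sub>M borel \<Otimes>\<^sub>M borel)"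
    for h :: "real \<Rightarrow> real \<Rightarrow> real \<Rightarrow> ennreal"
  proof -
    note [measurable (raw)] = borel_measurable_triple[OF h]
    show ?thesis
      by (simp add: nn_integral_density D_def nn_integral_cmult[symmetric] mult.assoc)
  qed
  have D: "D (w + max 0 (x - y)) (w + max 0 (y - x)) (min x y) = D x y w" for x y w
  proof -
    have prod: "exponential_density \<alpha> p * (exponential_density \<beta> q * exponential_density (\<alpha> + \<beta>) r) =
      (if p < 0 \<or> q < 0 \<or> r < 0 then 0 else \<alpha> * \<beta> * (\<alpha> + \<beta>) * exp (- (\<alpha> * p + \<beta> * q + (\<alpha> + \<beta>) * r)))" for p q r
    proof -
      have "exp (- (\<alpha> * p + \<beta> * q + (\<alpha> + \<beta>) * r)) = exp (- p * \<alpha>) * (exp (- q * \<beta>) * exp (- r * (\<alpha> + \<beta>)))"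
        by (simp add: exp_add[symmetric] algebra_simps)
      then show ?thesis by (simp add: exponential_density_def)
    qed
    have "\<alpha> * (w + max 0 (x - y)) + \<beta> * (w + max 0 (y - x)) + (\<alpha> + \<beta>) * min x y = \<alpha> * x + \<beta> * y + (\<alpha> + \<beta>) * w"
      by (simp add: max_def min_def algebra_simps)
    moreover have "w + max 0 (x - y) < 0 \<or> w + max 0 (y - x) < 0 \<or> min x y < 0 \<longleftrightarrow> x < 0 \<or> y < 0 \<or> w < 0"
      by (auto simp: max_def min_def)
    ultimately have "exponential_density \<alpha> (w + max 0 (x - y)) * (exponential_density \<beta> (w + max 0 (y - x)) * exponential_density (\<alpha> + \<beta>) (min x y))
      = exponential_density \<alpha> x * (exponential_density \<beta> y * exponential_density (\<alpha> + \<beta>) w)"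
      unfolding prod by simp
    then show ?thesis
      using pos by (simp add: D_def ennreal_mult[symmetric] erlang_density_nonneg)
  qed
  have "?L = (\<integral>\<^sup>+x. \<integral>\<^sup>+y. \<integral>\<^sup>+w. D (w + max 0 (x - y)) (w + max 0 (y - x)) (min x y) *
      f (w + max 0 (x - y)) (w + max 0 (y - x)) (min x y) \<partial>lborel \<partial>lborel \<partial>lborel)"
    by (subst expand) (measurable, simp add: D)
  also have "\<dots> = (\<integral>\<^sup>+x. \<integral>\<^sup>+y. \<integral>\<^sup>+w. D x y w * f x y w \<partial>lborel \<partial>lborel \<partial>lborel)"
    by (rule nn_integral_lborel_flip) measurable
  also have "\<dots> = ?R"
    by (subst expand) simp_all
  finally show ?thesis .
qed

lemma nn_integral_exp_distr_scale:
  fixes f :: "real \<Rightarrow> ennreal"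
  assumes [measurable]: "f \<in> borel_measurable borel" and r: "0 < r"
  shows "(\<integral>\<^sup>+x. f x \<partial>exp_distr r) = (\<integral>\<^sup>+x. f (x / r) \<partial>exp_distr 1)"
proof -
  have dens: "ennreal (1 / r) * ennreal (exponential_density r (x / r)) = ennreal (exponential_density 1 x)" for x
    using r by (simp add: ennreal_mult[symmetric] erlang_density_nonneg)
       (auto simp: exponential_density_def field_simps)
  have "(\<integral>\<^sup>+x. f x \<partial>exp_distr r) = (\<integral>\<^sup>+x. exponential_density r x * f x \<partial>lborel)"
    by (simp add: nn_integral_density)
  also have "\<dots> = ennreal (1 / r) * (\<integral>\<^sup>+x. exponential_density r (x / r) * f (x / r) \<partial>lborel)"
    using r by (subst nn_integral_real_affine[where c = "1 / r" and t = 0]) auto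
  also have "\<dots> = (\<integral>\<^sup>+x. f (x / r) \<partial>exp_distr 1)"
    by (simp add: nn_integral_density nn_integral_cmult[symmetric] mult.assoc[symmetric] dens)
  finally show ?thesis .
qed

lemma nn_integral_unit_exp_flip:
  fixes f :: "real \<Rightarrow> real \<Rightarrow> real \<Rightarrow> ennreal"
  assumes f: "(\<lambda>(x, y, w). f x y w) \<in> borel_measurable (borel \<Otimes>\<^sub>M borel \<Otimes>\<^sub>M borel)"
    and pos: "0 < \<alpha>" "0 < \<beta>"
  shows "(\<integral>\<^sup>+x. \<integral>\<^sup>+y. \<integral>\<^sup>+w. f (\<alpha> * (w / (\<alpha> + \<beta>) + max 0 (x / \<alpha> - y / \<beta>)))
        (\<beta> * (w / (\<alpha> + \<beta>) + max 0 (y / \<beta> - x / \<alpha>))) ((\<alpha> + \<beta>) * min (x / \<alpha>) (y / \<beta>))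
      \<partial>exp_distr 1 \<partial>exp_distr 1 \<partial>exp_distr 1) =
    (\<integral>\<^sup>+x. \<integral>\<^sup>+y. \<integral>\<^sup>+w. f x y w \<partial>exp_distr 1 \<partial>exp_distr 1 \<partial>exp_distr 1)"
proof -
  note [measurable (raw)] = borel_measurable_triple[OF f]
  interpret Ea: prob_space "exp_distr \<alpha>" using pos by (intro prob_space_exponential_density)
  interpret Eb: prob_space "exp_distr \<beta>" using pos by (intro prob_space_exponential_density)
  interpret E1: prob_space "exp_distr 1" by (intro prob_space_exponential_density) simp
  have scale: "(\<integral>\<^sup>+x. \<integral>\<^sup>+y. \<integral>\<^sup>+w. h x y w \<partial>exp_distr (\<alpha> + \<beta>) \<partial>exp_distr \<beta> \<partial>exp_distr \<alpha>) =
    (\<integral>\<^sup>+x. \<integral>\<^sup>+y. \<integral>\<^sup>+w. h (x / \<alpha>) (y / \<beta>) (w / (\<alpha> + \<beta>)) \<partial>exp_distr 1 \<partial>exp_distr 1 \<partial>exp_distr 1)"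
    if h: "(\<lambda>(x, y, w). h x y w) \<in> borel_measurable (borel \<Otimes>\<^sub>M borel \<Otimes>\<^sub>M borel)"
    for h :: "real \<Rightarrow> real \<Rightarrow> real \<Rightarrow> ennreal"
  proof -
    note [measurable (raw)] = borel_measurable_triple[OF h]
    have "(\<integral>\<^sup>+x. \<integral>\<^sup>+y. \<integral>\<^sup>+w. h x y w \<partial>exp_distr (\<alpha> + \<beta>) \<partial>exp_distr \<beta> \<partial>exp_distr \<alpha>) =
      (\<integral>\<^sup>+x. \<integral>\<^sup>+y. \<integral>\<^sup>+w. h x y (w / (\<alpha> + \<beta>)) \<partial>exp_distr 1 \<partial>exp_distr \<beta> \<partial>exp_distr \<alpha>)"
      using pos by (intro nn_integral_cong nn_integral_exp_distr_scale) auto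
    also have "\<dots> = (\<integral>\<^sup>+x. \<integral>\<^sup>+y. \<integral>\<^sup>+w. h x (y / \<beta>) (w / (\<alpha> + \<beta>)) \<partial>exp_distr 1 \<partial>exp_distr 1 \<partial>exp_distr \<alpha>)"
      using pos by (intro nn_integral_cong nn_integral_exp_distr_scale) auto
    also have "\<dots> = (\<integral>\<^sup>+x. \<integral>\<^sup>+y. \<integral>\<^sup>+w. h (x / \<alpha>) (y / \<beta>) (w / (\<alpha> + \<beta>)) \<partial>exp_distr 1 \<partial>exp_distr 1 \<partial>exp_distr 1)"
      using pos by (intro nn_integral_exp_distr_scale) auto
    finally show ?thesis .
  qed
  let ?g = "\<lambda>x y w. f (\<alpha> * x) (\<beta> * y) ((\<alpha> + \<beta>) * w)"
  have "(\<integral>\<^sup>+x. \<integral>\<^sup>+y. \<integral>\<^sup>+w. ?g (w + max 0 (x - y)) (w + max 0 (y - x)) (min x y)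
      \<partial>exp_distr (\<alpha> + \<beta>) \<partial>exp_distr \<beta> \<partial>exp_distr \<alpha>) =
    (\<integral>\<^sup>+x. \<integral>\<^sup>+y. \<integral>\<^sup>+w. ?g x y w \<partial>exp_distr (\<alpha> + \<beta>) \<partial>exp_distr \<beta> \<partial>exp_distr \<alpha>)"
    by (rule nn_integral_exp_flip) (use pos in auto)
  then show ?thesis
    using pos by (simp add: scale)
qed

text \<open>The index \<open>i\<close> may already belong to \<open>I\<close>; integrating then resamples that coordinate. In this way
  single coordinates of a product over all indices can be integrated out.\<close>

lemma nn_integral_PiM_insert:
  assumes M: "\<And>i. prob_space (M i)" and [measurable]: "f \<in> borel_measurable (PiM (insert i I) M)"
  shows "(\<integral>\<^sup>+X. f X \<partial>PiM (insert i I) M) = (\<integral>\<^sup>+X. \<integral>\<^sup>+x. f (X(i := x)) \<partial>M i \<partial>PiM I M)"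
    and "(\<lambda>X. \<integral>\<^sup>+x. f (X(i := x)) \<partial>M i) \<in> borel_measurable (PiM I M)"
proof -
  interpret Mi: prob_space "M i" by (rule M)
  interpret I: prob_space "PiM I M" by (intro prob_space_PiM M)
  interpret pair_sigma_finite "M i" "PiM I M" ..
  have [measurable]: "(\<lambda>(x, X). X(i := x)) \<in> M i \<Otimes>\<^sub>M PiM I M \<rightarrow>\<^sub>M PiM (insert i I) M"
    by measurable
  have "(\<integral>\<^sup>+X. f X \<partial>PiM (insert i I) M) =
    (\<integral>\<^sup>+X. f X \<partial>distr (M i \<Otimes>\<^sub>M PiM I M) (PiM (insert i I) M) (\<lambda>(x, X). X(i := x)))"
    by (subst distr_pair_PiM_eq_PiM) (auto intro: M)
  also have "\<dots> = (\<integral>\<^sup>+p. (\<lambda>(x, X). f (X(i := x))) p \<partial>(M i \<Otimes>\<^sub>M PiM I M))"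
    by (subst nn_integral_distr) (auto simp: case_prod_beta' intro!: nn_integral_cong)
  also have "\<dots> = (\<integral>\<^sup>+X. \<integral>\<^sup>+x. f (X(i := x)) \<partial>M i \<partial>PiM I M)"
    by (subst nn_integral_snd[symmetric]) auto
  finally show "(\<integral>\<^sup>+X. f X \<partial>PiM (insert i I) M) = (\<integral>\<^sup>+X. \<integral>\<^sup>+x. f (X(i := x)) \<partial>M i \<partial>PiM I M)" .
  show "(\<lambda>X. \<integral>\<^sup>+x. f (X(i := x)) \<partial>M i) \<in> borel_measurable (PiM I M)"
    by measurable
qed

text \<open>Coordinates \<open>(i, 0)\<close> and \<open>(0, j)\<close> hold the normalized increments of the last-passage time on the
  lower and the left edge of the unit square with upper right corner \<open>(i, j)\<close>. The flip replaces
  them by the increments on the upper and the right edge. Storing the minimum at \<open>(i, j)\<close> keeps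
  the third independent variable, so that the flip preserves the law of the whole configuration and flips
  can be composed.\<close>

definition corner_flip :: "real \<Rightarrow> real \<Rightarrow> nat \<Rightarrow> nat \<Rightarrow> (nat \<times> nat \<Rightarrow> real) \<Rightarrow> nat \<times> nat \<Rightarrow> real" where
  "corner_flip \<alpha> \<beta> i j s = s(
     (i, 0) := \<alpha> * (s (i, j) / (\<alpha> + \<beta>) + max 0 (s (i, 0) / \<alpha> - s (0, j) / \<beta>)),
     (0, j) := \<beta> * (s (i, j) / (\<alpha> + \<beta>) + max 0 (s (0, j) / \<beta> - s (i, 0) / \<alpha>)),
     (i, j) := (\<alpha> + \<beta>) * min (s (i, 0) / \<alpha>) (s (0, j) / \<beta>))"

lemma measurable_corner_flip [measurable]: "corner_flip \<alpha> \<beta> i j \<in> noise \<rightarrow>\<^sub>M noise"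
proof -
  have [measurable]: "(\<lambda>s. (f s)(e := g s)) \<in> noise \<rightarrow>\<^sub>M noise"
    if [measurable]: "f \<in> noise \<rightarrow>\<^sub>M noise" "g \<in> borel_measurable noise" for f g e
  proof -
    have "f \<in> noise \<rightarrow>\<^sub>M (\<Pi>\<^sub>M _\<in>UNIV. borel)"
      using that(1) unfolding measurable_cong_sets[OF refl sets_noise] .
    then show ?thesis
      unfolding measurable_cong_sets[OF refl sets_noise]
      by (intro measurable_fun_upd[of _ UNIV e]) auto
  qed
  show ?thesis
    unfolding corner_flip_def[abs_def] by measurable
qed

lemma nn_integral_noise_split:
  assumes f: "f \<in> borel_measurable noise"
  shows "(\<integral>\<^sup>+s. f s \<partial>noise) = (\<integral>\<^sup>+s. \<integral>\<^sup>+x. \<integral>\<^sup>+y. \<integral>\<^sup>+w. f (s(e1 := x, e2 := y, e3 := w))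
    \<partial>exp_distr 1 \<partial>exp_distr 1 \<partial>exp_distr 1 \<partial>(\<Pi>\<^sub>M _\<in>UNIV. exp_distr 1))"
proof -
  have E: "prob_space (exp_distr 1)" by (rule prob_space_exponential_density) simp
  note ins = nn_integral_PiM_insert[of "\<lambda>_. exp_distr 1" _ _ "UNIV :: (nat \<times> nat) set", OF E]
  have f: "f \<in> borel_measurable (\<Pi>\<^sub>M _\<in>insert e3 UNIV. exp_distr 1)"
    using f by (simp add: noise_def)
  have f': "(\<lambda>s. \<integral>\<^sup>+w. f (s(e3 := w)) \<partial>exp_distr 1) \<in> borel_measurable (\<Pi>\<^sub>M _\<in>insert e2 UNIV. exp_distr 1)"
    using ins(2)[OF f] by simp
  have f'': "(\<lambda>s. \<integral>\<^sup>+y. \<integral>\<^sup>+w. f (s(e2 := y, e3 := w)) \<partial>exp_distr 1 \<partial>exp_distr 1) \<in> borel_measurable (\<Pi>\<^sub>M _\<in>insert e1 UNIV. exp_distr 1)"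
    using ins(2)[OF f'] by simp
  show ?thesis
    using ins(1)[OF f] ins(1)[OF f'] ins(1)[OF f''] by (simp add: noise_def)
qed

lemma distr_corner_flip:
  assumes pos: "0 < \<alpha>" "0 < \<beta>" and ij: "1 \<le> i" "1 \<le> j"
  shows "distr noise noise (corner_flip \<alpha> \<beta> i j) = noise"
proof (rule measure_eqI)
  fix A assume "A \<in> sets (distr noise noise (corner_flip \<alpha> \<beta> i j))"
  then have A[measurable]: "A \<in> sets noise" by simp
  note split = nn_integral_noise_split[of _ "(i, 0)" "(0, j)" "(i, j)"]
  have "emeasure (distr noise noise (corner_flip \<alpha> \<beta> i j)) A = (\<integral>\<^sup>+s. indicator A s \<partial>distr noise noise (corner_flip \<alpha> \<beta> i j))"
    by simp
  also have "\<dots> = (\<integral>\<^sup>+s. indicator A (corner_flip \<alpha> \<beta> i j s) \<partial>noise)"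
    by (rule nn_integral_distr) measurable
  also have "\<dots> = (\<integral>\<^sup>+s. indicator A s \<partial>noise)"
  proof (subst (1 2) split)
    have up: "(\<lambda>(x, y, w). s((i, 0) := x, (0, j) := y, (i, j) := w)) \<in> borel \<Otimes>\<^sub>M borel \<Otimes>\<^sub>M borel \<rightarrow>\<^sub>M noise" for s
      unfolding measurable_cong_sets[OF refl sets_noise] case_prod_beta'
      by (intro measurable_fun_upd[of _ UNIV]) (auto simp: space_PiM)
    have flip: "corner_flip \<alpha> \<beta> i j (s((i, 0) := x, (0, j) := y, (i, j) := w)) =
      s((i, 0) := \<alpha> * (w / (\<alpha> + \<beta>) + max 0 (x / \<alpha> - y / \<beta>)),
        (0, j) := \<beta> * (w / (\<alpha> + \<beta>) + max 0 (y / \<beta> - x / \<alpha>)),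
        (i, j) := (\<alpha> + \<beta>) * min (x / \<alpha>) (y / \<beta>))" for s x y w
      using ij by (auto simp: corner_flip_def fun_eq_iff)
    have ind: "(\<lambda>(x, y, w). indicator A (s((i, 0) := x, (0, j) := y, (i, j) := w)) :: ennreal)
      \<in> borel_measurable (borel \<Otimes>\<^sub>M borel \<Otimes>\<^sub>M borel)" for s
      using measurable_compose[OF up borel_measurable_indicator[OF A], of s] by (simp add: case_prod_beta')
    show "(\<integral>\<^sup>+s. \<integral>\<^sup>+x. \<integral>\<^sup>+y. \<integral>\<^sup>+w. indicator A (corner_flip \<alpha> \<beta> i j (s((i, 0) := x, (0, j) := y, (i, j) := w)))
        \<partial>exp_distr 1 \<partial>exp_distr 1 \<partial>exp_distr 1 \<partial>(\<Pi>\<^sub>M _\<in>UNIV. exp_distr 1)) =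
      (\<integral>\<^sup>+s. \<integral>\<^sup>+x. \<integral>\<^sup>+y. \<integral>\<^sup>+w. indicator A (s((i, 0) := x, (0, j) := y, (i, j) := w))
        \<partial>exp_distr 1 \<partial>exp_distr 1 \<partial>exp_distr 1 \<partial>(\<Pi>\<^sub>M _\<in>UNIV. exp_distr 1))"
      unfolding flip by (intro nn_integral_cong nn_integral_unit_exp_flip[OF ind pos])
  qed measurable
  also have "\<dots> = emeasure noise A" by simp
  finally show "emeasure (distr noise noise (corner_flip \<alpha> \<beta> i j)) A = emeasure noise A" .
qed simp

text \<open>With \<open>\<alpha> i = a i + z\<close> and \<open>\<beta> j = b j - z\<close> the bulk rates \<open>\<alpha> i + \<beta> j\<close> do not depend on \<open>z\<close>.\<close>

definition stat_weight :: "(nat \<Rightarrow> real) \<Rightarrow> (nat \<Rightarrow> real) \<Rightarrow> (nat \<times> nat \<Rightarrow> real) \<Rightarrow> nat \<Rightarrow> nat \<Rightarrow> real" where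
  "stat_weight \<alpha> \<beta> s i j =
    (if j = 0 then s (i, 0) / \<alpha> i else if i = 0 then s (0, j) / \<beta> j else s (i, j) / (\<alpha> i + \<beta> j))"

primrec flip_column :: "(nat \<Rightarrow> real) \<Rightarrow> (nat \<Rightarrow> real) \<Rightarrow> nat \<Rightarrow> nat \<Rightarrow> (nat \<times> nat \<Rightarrow> real) \<Rightarrow> nat \<times> nat \<Rightarrow> real" where
  "flip_column \<alpha> \<beta> i 0 s = s"
| "flip_column \<alpha> \<beta> i (Suc j) s = corner_flip (\<alpha> i) (\<beta> (Suc j)) i (Suc j) (flip_column \<alpha> \<beta> i j s)"

primrec flip_box :: "(nat \<Rightarrow> real) \<Rightarrow> (nat \<Rightarrow> real) \<Rightarrow> nat \<Rightarrow> nat \<Rightarrow> (nat \<times> nat \<Rightarrow> real) \<Rightarrow> nat \<times> nat \<Rightarrow> real" where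
  "flip_box \<alpha> \<beta> 0 l s = s"
| "flip_box \<alpha> \<beta> (Suc i) l s = flip_column \<alpha> \<beta> (Suc i) l (flip_box \<alpha> \<beta> i l s)"

lemma measurable_flip_column [measurable]: "flip_column \<alpha> \<beta> i j \<in> noise \<rightarrow>\<^sub>M noise"
  by (induction j) (simp_all add: measurable_compose[OF _ measurable_corner_flip])

lemma measurable_flip_box [measurable]: "flip_box \<alpha> \<beta> i l \<in> noise \<rightarrow>\<^sub>M noise"
  by (induction i) (simp_all add: measurable_compose[OF _ measurable_flip_column])

lemma distr_noise_compose:
  assumes [measurable]: "f \<in> noise \<rightarrow>\<^sub>M noise" "g \<in> noise \<rightarrow>\<^sub>M noise"
    and "distr noise noise f = noise" "distr noise noise g = noise"
  shows "distr noise noise (\<lambda>s. g (f s)) = noise"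
  using distr_distr[OF assms(2,1)] assms(3,4) by (simp add: comp_def)

lemma distr_flip_column:
  assumes "\<And>i. 1 \<le> i \<Longrightarrow> 0 < \<alpha> i" "\<And>j. 1 \<le> j \<Longrightarrow> 0 < \<beta> j" "1 \<le> i"
  shows "distr noise noise (flip_column \<alpha> \<beta> i j) = noise"
proof (induction j)
  case 0
  then show ?case by (simp add: distr_id2)
next
  case (Suc j)
  then show ?case using assms by (simp add: distr_noise_compose distr_corner_flip)
qed

lemma distr_flip_box:
  assumes "\<And>i. 1 \<le> i \<Longrightarrow> 0 < \<alpha> i" "\<And>j. 1 \<le> j \<Longrightarrow> 0 < \<beta> j"
  shows "distr noise noise (flip_box \<alpha> \<beta> i l) = noise"
proof (induction i)
  case 0
  then show ?case by (simp add: distr_id2)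
next
  case (Suc i)
  then show ?case using assms by (simp add: distr_noise_compose distr_flip_column)
qed

text \<open>Invariant of the flips in column \<open>p + 1\<close>: after \<open>j\<close> of them, the coordinates \<open>(0, q + 1)\<close> for \<open>q < j\<close> have moved
  from the vertical increments of column \<open>p\<close> to those of column \<open>p + 1\<close>, and coordinate \<open>(p + 1, 0)\<close>
  has moved up to the horizontal increment at height \<open>j\<close>.\<close>

lemma flip_column_increments:
  fixes s t :: "nat \<times> nat \<Rightarrow> real"
  assumes pos: "\<And>i. 1 \<le> i \<Longrightarrow> 0 < \<alpha> i" "\<And>j. 1 \<le> j \<Longrightarrow> 0 < \<beta> j"
  defines "L \<equiv> lpp (stat_weight \<alpha> \<beta> s)"
  assumes t: "\<And>q. q < l \<Longrightarrow> t (0, Suc q) = \<beta> (Suc q) * (L p (Suc q) - L p q)"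
    and fresh: "\<And>i j. p < i \<Longrightarrow> t (i, j) = s (i, j)"
  shows "j \<le> l \<Longrightarrow> (\<forall>q<j. flip_column \<alpha> \<beta> (Suc p) j t (0, Suc q) = \<beta> (Suc q) * (L (Suc p) (Suc q) - L (Suc p) q)) \<and>
    flip_column \<alpha> \<beta> (Suc p) j t (Suc p, 0) = \<alpha> (Suc p) * (L (Suc p) j - L p j) \<and>
    (\<forall>q. j < q \<longrightarrow> flip_column \<alpha> \<beta> (Suc p) j t (0, q) = t (0, q)) \<and>
    (\<forall>q. j < q \<longrightarrow> flip_column \<alpha> \<beta> (Suc p) j t (Suc p, q) = s (Suc p, q)) \<and>
    (\<forall>i q. Suc p < i \<longrightarrow> flip_column \<alpha> \<beta> (Suc p) j t (i, q) = s (i, q))"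
proof (induction j)
  case 0
  then show ?case
    using pos(1)[of "Suc p"] by (auto simp: fresh L_def stat_weight_def)
next
  case (Suc j)
  let ?u = "flip_column \<alpha> \<beta> (Suc p) j t"
  let ?w = "s (Suc p, Suc j) / (\<alpha> (Suc p) + \<beta> (Suc j))"
  have a: "0 < \<alpha> (Suc p)" and b: "0 < \<beta> (Suc j)" using pos by auto
  have x: "?u (Suc p, 0) / \<alpha> (Suc p) = L (Suc p) j - L p j"
    using Suc a by simp
  have y: "?u (0, Suc j) / \<beta> (Suc j) = L p (Suc j) - L p j"
    using Suc b t[of j] by simp
  have w: "?u (Suc p, Suc j) = s (Suc p, Suc j)"
    using Suc by simp
  have rec: "L (Suc p) (Suc j) = ?w + max (L p (Suc j)) (L (Suc p) j)"
    by (simp add: L_def stat_weight_def)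
  have "?w + max 0 ((L (Suc p) j - L p j) - (L p (Suc j) - L p j)) = L (Suc p) (Suc j) - L p (Suc j)"
    "?w + max 0 ((L p (Suc j) - L p j) - (L (Suc p) j - L p j)) = L (Suc p) (Suc j) - L (Suc p) j"
    unfolding rec by (auto simp: max_def)
  then have new: "flip_column \<alpha> \<beta> (Suc p) (Suc j) t = ?u((Suc p, 0) := \<alpha> (Suc p) * (L (Suc p) (Suc j) - L p (Suc j)),
      (0, Suc j) := \<beta> (Suc j) * (L (Suc p) (Suc j) - L (Suc p) j),
      (Suc p, Suc j) := (\<alpha> (Suc p) + \<beta> (Suc j)) * min (L (Suc p) j - L p j) (L p (Suc j) - L p j))"
    by (simp add: corner_flip_def x y w)
  show ?case
    unfolding new using Suc by (auto simp: less_Suc_eq)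
qed

lemma flip_box_increments:
  assumes pos: "\<And>i. 1 \<le> i \<Longrightarrow> 0 < \<alpha> i" "\<And>j. 1 \<le> j \<Longrightarrow> 0 < \<beta> j"
  shows "(\<forall>q<l. flip_box \<alpha> \<beta> i l s (0, Suc q) =
      \<beta> (Suc q) * (lpp (stat_weight \<alpha> \<beta> s) i (Suc q) - lpp (stat_weight \<alpha> \<beta> s) i q)) \<and>
    (\<forall>p j. i < p \<longrightarrow> flip_box \<alpha> \<beta> i l s (p, j) = s (p, j))"
proof (induction i)
  case 0
  have "\<beta> (Suc q) \<noteq> 0" for q
    using pos(2)[of "Suc q"] by simp
  then show ?case by (auto simp: stat_weight_def)
next
  case (Suc i)
  show ?case
    using flip_column_increments[where \<alpha> = \<alpha> and \<beta> = \<beta> and s = s and t = "flip_box \<alpha> \<beta> i l s" and p = i and l = l and j = l]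
      Suc pos by simp
qed

text \<open>Follow the lower edge of the box and then its right edge. The increments on the right edge are,
  up to normalization, coordinates of a flipped configuration, which has the same law as \<open>s\<close>.\<close>

lemma stationary_lpp_eq_sums:
  assumes pos: "\<And>i. 1 \<le> i \<Longrightarrow> 0 < \<alpha> i" "\<And>j. 1 \<le> j \<Longrightarrow> 0 < \<beta> j"
  shows "lpp (stat_weight \<alpha> \<beta> s) m l =
    (\<Sum>i=1..m. s (i, 0) / \<alpha> i) + (\<Sum>j=1..l. flip_box \<alpha> \<beta> m l s (0, j) / \<beta> j)"
proof -
  let ?L = "lpp (stat_weight \<alpha> \<beta> s) m"
  have "(\<Sum>j=1..l. flip_box \<alpha> \<beta> m l s (0, j) / \<beta> j) = (\<Sum>j<l. flip_box \<alpha> \<beta> m l s (0, Suc j) / \<beta> (Suc j))"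
    by (simp add: sum.atLeast1_atMost_eq)
  also have "\<dots> = (\<Sum>j<l. ?L (Suc j) - ?L j)"
  proof (intro sum.cong refl)
    fix j assume "j \<in> {..<l}"
    then show "flip_box \<alpha> \<beta> m l s (0, Suc j) / \<beta> (Suc j) = ?L (Suc j) - ?L j"
      using flip_box_increments[of \<alpha> \<beta> l m s, OF pos] pos(2)[of "Suc j"] by simp
  qed
  also have "\<dots> = ?L l - ?L 0"
    by (rule sum_lessThan_telescope)
  finally show ?thesis
    by (simp add: lpp_first_axis stat_weight_def)
qed

section \<open>Concentration of sums of independent exponentials\<close>

lemma nn_integral_noise_prod:
  assumes K: "finite K" and [measurable]: "\<And>e. e \<in> K \<Longrightarrow> g e \<in> borel_measurable borel"
  shows "(\<integral>\<^sup>+s. (\<Prod>e\<in>K. g e (s e)) \<partial>noise) = (\<Prod>e\<in>K. \<integral>\<^sup>+x. g e x \<partial>exp_distr 1)"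
proof -
  interpret E: prob_space "exp_distr 1"
    by (rule prob_space_exponential_density) simp
  interpret product_prob_space "\<lambda>_ :: nat \<times> nat. exp_distr 1" UNIV ..
  have [measurable]: "(\<lambda>x. \<Prod>e\<in>K. g e (x e)) \<in> borel_measurable (\<Pi>\<^sub>M _\<in>K. exp_distr 1)"
  proof (intro borel_measurable_prod_ennreal)
    fix e assume e: "e \<in> K"
    have "(\<lambda>x. x e) \<in> (\<Pi>\<^sub>M _\<in>K. exp_distr 1) \<rightarrow>\<^sub>M exp_distr 1"
      using e by (rule measurable_component_singleton)
    then show "(\<lambda>x. g e (x e)) \<in> borel_measurable (\<Pi>\<^sub>M _\<in>K. exp_distr 1)"
      by (rule measurable_compose) (use assms(2)[OF e] in simp)
  qed
  have "(\<integral>\<^sup>+s. (\<Prod>e\<in>K. g e (s e)) \<partial>noise) =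
    (\<integral>\<^sup>+x. (\<Prod>e\<in>K. g e (x e)) \<partial>distr noise (\<Pi>\<^sub>M _\<in>K. exp_distr 1) (\<lambda>s. restrict s K))"
    unfolding noise_def by (subst nn_integral_distr) (auto intro!: nn_integral_cong prod.cong)
  also have "distr noise (\<Pi>\<^sub>M _\<in>K. exp_distr 1) (\<lambda>s. restrict s K) = (\<Pi>\<^sub>M _\<in>K. exp_distr 1)"
    unfolding noise_def by (rule distr_PiM_restrict_finite) (use K in auto)
  also have "(\<integral>\<^sup>+x. (\<Prod>e\<in>K. g e (x e)) \<partial>(\<Pi>\<^sub>M _\<in>K. exp_distr 1)) = (\<Prod>e\<in>K. \<integral>\<^sup>+x. g e x \<partial>exp_distr 1)"
    by (intro product_nn_integral_prod K) auto
  finally show ?thesis .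
qed

text \<open>The moment generating function at \<open>\<theta>\<close> equals \<open>1 / (1 - \<theta>)\<close>, because tilting by \<open>exp (\<theta> * x)\<close> turns the rate \<open>1\<close>
  into \<open>1 - \<theta>\<close>.\<close>

lemma exp_distr_mgf_bound:
  fixes \<theta> :: real
  assumes \<theta>: "\<bar>\<theta>\<bar> \<le> 1 / 2"
  shows "(\<integral>\<^sup>+x. ennreal (exp (\<theta> * (x - 1))) \<partial>exp_distr 1) \<le> ennreal (exp (2 * \<theta>\<^sup>2))"
proof -
  interpret E: prob_space "exp_distr (1 - \<theta>)"
    using \<theta> by (intro prob_space_exponential_density) auto
  have "(\<integral>\<^sup>+x. ennreal (exp (\<theta> * (x - 1))) \<partial>exp_distr 1) =
    (\<integral>\<^sup>+x. ennreal (exp (- \<theta>) / (1 - \<theta>)) * ennreal (exponential_density (1 - \<theta>) x) \<partial>lborel)"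
  proof (subst nn_integral_density)
    show "(\<integral>\<^sup>+x. ennreal (exponential_density 1 x) * ennreal (exp (\<theta> * (x - 1))) \<partial>lborel) =
      (\<integral>\<^sup>+x. ennreal (exp (- \<theta>) / (1 - \<theta>)) * ennreal (exponential_density (1 - \<theta>) x) \<partial>lborel)"
    proof (intro nn_integral_cong)
      fix x :: real
      have "exp (- x) * exp (\<theta> * (x - 1)) = exp (- \<theta>) * exp (- x * (1 - \<theta>))"
        by (simp add: exp_add[symmetric] algebra_simps)
      then have "exponential_density 1 x * exp (\<theta> * (x - 1)) = exp (- \<theta>) / (1 - \<theta>) * exponential_density (1 - \<theta>) x"
        using \<theta> by (auto simp: exponential_density_def)
      then show "ennreal (exponential_density 1 x) * ennreal (exp (\<theta> * (x - 1))) =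
          ennreal (exp (- \<theta>) / (1 - \<theta>)) * ennreal (exponential_density (1 - \<theta>) x)"
        using \<theta> by (simp add: ennreal_mult[symmetric] erlang_density_nonneg)
    qed
  qed auto
  also have "\<dots> = ennreal (exp (- \<theta>) / (1 - \<theta>)) * emeasure (exp_distr (1 - \<theta>)) (space (exp_distr (1 - \<theta>)))"
    by (simp add: nn_integral_cmult emeasure_density)
  also have "\<dots> = ennreal (exp (- \<theta>) / (1 - \<theta>))"
    by (simp only: E.emeasure_space_1) simp
  also have "exp (- \<theta>) / (1 - \<theta>) \<le> exp (2 * \<theta>\<^sup>2)"
  proof -
    have "\<bar>ln (1 + - \<theta>) - (- \<theta>)\<bar> \<le> 2 * (- \<theta>)\<^sup>2"
      by (rule abs_ln_one_plus_x_minus_x_bound) (use \<theta> in auto)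
    then have "- \<theta> - 2 * \<theta>\<^sup>2 \<le> ln (1 - \<theta>)"
      by simp
    then have "exp (- \<theta> - 2 * \<theta>\<^sup>2) \<le> 1 - \<theta>"
      using \<theta> by (subst (asm) ln_ge_iff) auto
    then have "exp (- \<theta>) \<le> exp (2 * \<theta>\<^sup>2) * (1 - \<theta>)"
      by (simp add: exp_diff field_simps)
    then show ?thesis
      using \<theta> by (simp add: field_simps)
  qed
  finally show ?thesis
    by (simp add: ennreal_leI)
qed

lemma noise_chernoff:
  fixes c :: "nat \<times> nat \<Rightarrow> real"
  assumes K: "finite K" and \<theta>: "0 \<le> \<theta>" "\<And>e. e \<in> K \<Longrightarrow> \<theta> * \<bar>c e\<bar> \<le> 1 / 2"
  shows "measure noise {s. t \<le> (\<Sum>e\<in>K. c e * (s e - 1))} \<le> exp (2 * \<theta>\<^sup>2 * (\<Sum>e\<in>K. (c e)\<^sup>2) - \<theta> * t)"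
proof -
  interpret prob_space noise by (rule prob_space_noise)
  let ?X = "\<lambda>s. \<Sum>e\<in>K. c e * (s e - 1)"
  have [measurable]: "{s. t \<le> ?X s} \<in> sets noise"
  proof -
    have "{s \<in> space noise. t \<le> ?X s} \<in> sets noise" by measurable
    then show ?thesis by simp
  qed
  have "emeasure noise {s. t \<le> ?X s} = (\<integral>\<^sup>+s. indicator {s. t \<le> ?X s} s \<partial>noise)"
    by simp
  also have "\<dots> \<le> (\<integral>\<^sup>+s. ennreal (exp (- \<theta> * t)) * (\<Prod>e\<in>K. ennreal (exp (\<theta> * c e * (s e - 1)))) \<partial>noise)"
  proof (intro nn_integral_mono)
    fix s
    have "exp (- \<theta> * t) * (\<Prod>e\<in>K. exp (\<theta> * c e * (s e - 1))) = exp (\<theta> * (?X s - t))"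
      by (simp add: exp_sum[OF K, symmetric] exp_add[symmetric] sum_distrib_left algebra_simps)
    then have "ennreal (exp (- \<theta> * t)) * (\<Prod>e\<in>K. ennreal (exp (\<theta> * c e * (s e - 1)))) = ennreal (exp (\<theta> * (?X s - t)))"
      by (simp add: prod_ennreal ennreal_mult[symmetric] prod_nonneg)
    moreover have "ennreal 1 \<le> ennreal (exp (\<theta> * (?X s - t)))" if "t \<le> ?X s"
      using \<theta>(1) that by (intro ennreal_leI) simp
    ultimately show "indicator {s. t \<le> ?X s} s \<le> ennreal (exp (- \<theta> * t)) * (\<Prod>e\<in>K. ennreal (exp (\<theta> * c e * (s e - 1))))"
      by (auto simp: indicator_def)
  qed
  also have "\<dots> = ennreal (exp (- \<theta> * t)) * (\<Prod>e\<in>K. \<integral>\<^sup>+x. ennreal (exp (\<theta> * c e * (x - 1))) \<partial>exp_distr 1)"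
    by (subst nn_integral_cmult)
      (auto simp: nn_integral_noise_prod[OF K, of "\<lambda>e x. ennreal (exp (\<theta> * c e * (x - 1)))"]
        intro!: borel_measurable_prod_ennreal)
  also have "\<dots> \<le> ennreal (exp (- \<theta> * t)) * (\<Prod>e\<in>K. ennreal (exp (2 * (\<theta> * c e)\<^sup>2)))"
    using \<theta> by (intro mult_left_mono prod_mono_ennreal exp_distr_mgf_bound) (auto simp: abs_mult)
  also have "\<dots> = ennreal (exp (2 * \<theta>\<^sup>2 * (\<Sum>e\<in>K. (c e)\<^sup>2) - \<theta> * t))"
    by (simp add: prod_ennreal ennreal_mult[symmetric] prod_nonneg exp_sum[OF K, symmetric] exp_add[symmetric]
        sum_distrib_left power_mult_distrib algebra_simps)
  finally show ?thesis
    by (simp add: emeasure_eq_measure)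
qed

text \<open>The sum of squares of the coefficients is at most \<open>n * M\<^sup>2\<close>, so the exponent in Chernoff's bound is at most
  \<open>n * (2 * \<theta>\<^sup>2 * M\<^sup>2 - \<theta> * \<delta>)\<close>. The choice of \<open>\<theta>\<close> makes the first term at most half of the second and keeps
  \<open>\<theta> * M \<le> 1 / 2\<close>. The rate depends on \<open>M\<close> and \<open>\<delta>\<close> only, not on the number of summands.\<close>

lemma noise_deviation:
  fixes c :: "nat \<times> nat \<Rightarrow> real"
  assumes K: "finite K" and M: "0 < M" and \<delta>: "0 < \<delta>"
    and c: "\<And>e. e \<in> K \<Longrightarrow> 0 \<le> c e \<and> c e \<le> M" and sum: "(\<Sum>e\<in>K. c e) \<le> real n * M"
  defines "\<theta> \<equiv> min (1 / (2 * M)) (\<delta> / (4 * M\<^sup>2))"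
  shows "measure noise {s. real n * \<delta> \<le> \<bar>(\<Sum>e\<in>K. c e * s e) - (\<Sum>e\<in>K. c e)\<bar>} \<le> 2 * exp (- (\<theta> * \<delta> / 2 * real n))"
proof -
  interpret prob_space noise by (rule prob_space_noise)
  have \<theta>: "0 \<le> \<theta>" "\<theta> \<le> 1 / (2 * M)" "\<theta> \<le> \<delta> / (4 * M\<^sup>2)"
    using M \<delta> by (auto simp: \<theta>_def)
  have \<theta>M: "\<theta> * M \<le> 1 / 2" "\<theta> * (4 * M\<^sup>2) \<le> \<delta>"
    using \<theta> M by (simp_all add: field_simps)
  have small: "\<theta> * \<bar>c e\<bar> \<le> 1 / 2" if "e \<in> K" for e
  proof -
    have "\<theta> * \<bar>c e\<bar> \<le> \<theta> * M" using c[OF that] \<theta>(1) by (intro mult_left_mono) auto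
    with \<theta>M show ?thesis by simp
  qed
  have "(\<Sum>e\<in>K. (c e)\<^sup>2) \<le> (\<Sum>e\<in>K. M * c e)"
    unfolding power2_eq_square by (intro sum_mono mult_right_mono) (use c in auto)
  also have "\<dots> = M * (\<Sum>e\<in>K. c e)" by (simp add: sum_distrib_left)
  also have "\<dots> \<le> M * (real n * M)" using sum M by (intro mult_left_mono) auto
  finally have V: "(\<Sum>e\<in>K. (c e)\<^sup>2) \<le> real n * M\<^sup>2" by (simp add: power2_eq_square mult.left_commute)
  have "2 * \<theta>\<^sup>2 * (\<Sum>e\<in>K. (c e)\<^sup>2) \<le> 2 * \<theta>\<^sup>2 * (real n * M\<^sup>2)"
    using V by (intro mult_left_mono) auto
  also have "\<dots> = \<theta> * (\<theta> * (4 * M\<^sup>2)) * real n / 2" by (simp add: power2_eq_square)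
  also have "\<dots> \<le> \<theta> * \<delta> * real n / 2"
    using \<theta>(1) \<theta>M(2) by (intro divide_right_mono mult_right_mono mult_left_mono) auto
  finally have exponent: "2 * \<theta>\<^sup>2 * (\<Sum>e\<in>K. (c e)\<^sup>2) - \<theta> * (real n * \<delta>) \<le> - (\<theta> * \<delta> / 2 * real n)"
    by (simp add: field_simps)
  have one_sided: "measure noise {s. real n * \<delta> \<le> (\<Sum>e\<in>K. d e * (s e - 1))} \<le> exp (- (\<theta> * \<delta> / 2 * real n))"
    if "\<And>e. (d e)\<^sup>2 = (c e)\<^sup>2" "\<And>e. \<bar>d e\<bar> = \<bar>c e\<bar>" for d
    using noise_chernoff[OF K \<theta>(1), of d "real n * \<delta>"] small exponent that
    by (simp add: order_trans)
  have dev: "(\<Sum>e\<in>K. c e * (s e - 1)) = (\<Sum>e\<in>K. c e * s e) - (\<Sum>e\<in>K. c e)"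
    "(\<Sum>e\<in>K. - c e * (s e - 1)) = (\<Sum>e\<in>K. c e) - (\<Sum>e\<in>K. c e * s e)" for s
    by (simp_all add: sum_subtractf[symmetric] algebra_simps)
  have "{s \<in> space noise. real n * \<delta> \<le> (\<Sum>e\<in>K. d e * (s e - 1))} \<in> events" for d by measurable
  then have meas: "{s. real n * \<delta> \<le> (\<Sum>e\<in>K. d e * (s e - 1))} \<in> events" for d by simp
  have "{s. real n * \<delta> \<le> \<bar>(\<Sum>e\<in>K. c e * s e) - (\<Sum>e\<in>K. c e)\<bar>} =
      {s. real n * \<delta> \<le> (\<Sum>e\<in>K. c e * (s e - 1))} \<union> {s. real n * \<delta> \<le> (\<Sum>e\<in>K. - c e * (s e - 1))}"
    unfolding dev by (auto simp: abs_if)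
  then have "measure noise {s. real n * \<delta> \<le> \<bar>(\<Sum>e\<in>K. c e * s e) - (\<Sum>e\<in>K. c e)\<bar>} \<le>
      measure noise {s. real n * \<delta> \<le> (\<Sum>e\<in>K. c e * (s e - 1))} + measure noise {s. real n * \<delta> \<le> (\<Sum>e\<in>K. - c e * (s e - 1))}"
    using measure_Un_le[OF meas meas, of c "\<lambda>e. - c e"] by simp
  then show ?thesis
    using one_sided[of c] one_sided[of "\<lambda>e. - c e"] by simp
qed

section \<open>Concentration and almost sure limits for the boundary model\<close>

lemma noise_family_deviation:
  fixes c :: "nat \<Rightarrow> real" and e :: "nat \<Rightarrow> nat \<times> nat"
  assumes K: "finite K" "inj_on e K" and M: "0 < M" and \<delta>: "0 < \<delta>"
    and c: "\<And>k. k \<in> K \<Longrightarrow> 0 \<le> c k \<and> c k \<le> M" and sum: "(\<Sum>k\<in>K. c k) \<le> real n * M"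
  shows "measure noise {s. real n * \<delta> \<le> \<bar>(\<Sum>k\<in>K. c k * s (e k)) - (\<Sum>k\<in>K. c k)\<bar>} \<le>
    2 * exp (- (min (1 / (2 * M)) (\<delta> / (4 * M\<^sup>2)) * \<delta> / 2 * real n))"
proof -
  define d where "d = c \<circ> the_inv_into K e"
  have d: "d (e k) = c k" if "k \<in> K" for k
    using the_inv_into_f_f[OF K(2) that] by (simp add: d_def)
  have sums: "(\<Sum>p\<in>e ` K. d p * s p) = (\<Sum>k\<in>K. c k * s (e k))" "(\<Sum>p\<in>e ` K. d p) = (\<Sum>k\<in>K. c k)"
    for s :: "nat \<times> nat \<Rightarrow> real"
    by (simp_all add: sum.reindex[OF K(2)] d)
  have "\<And>p. p \<in> e ` K \<Longrightarrow> 0 \<le> d p \<and> d p \<le> M"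
    using c by (auto simp: d)
  with noise_deviation[of "e ` K" M \<delta> d n] K(1) M \<delta> sum show ?thesis
    unfolding sums by simp
qed

lemma borel_measurable_lpp [measurable]:
  assumes "\<And>i j. (\<lambda>x. w x i j) \<in> borel_measurable M"
  shows "(\<lambda>x. lpp (w x) i j) \<in> borel_measurable M"
proof -
  have "\<forall>i j. i + j \<le> n \<longrightarrow> (\<lambda>x. lpp (w x) i j) \<in> borel_measurable M" for n
  proof (induction n)
    case (Suc n)
    show ?case
    proof (intro allI impI)
      fix i j assume "i + j \<le> Suc n"
      then show "(\<lambda>x. lpp (w x) i j) \<in> borel_measurable M"
        using Suc assms by (cases i; cases j) (auto intro!: borel_measurable_add borel_measurable_max)
    qed
  qed simp
  then show ?thesis by blast
qed

lemma borel_measurable_stat_weight [measurable]: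
  "(\<lambda>s. stat_weight \<alpha> \<beta> s i j) \<in> borel_measurable noise"
  unfolding stat_weight_def by measurable

lemma measure_noise_flip_box:
  assumes "\<And>i. 1 \<le> i \<Longrightarrow> 0 < \<alpha> i" "\<And>j. 1 \<le> j \<Longrightarrow> 0 < \<beta> j" and A: "{s. P s} \<in> sets noise"
  shows "measure noise {s. P (flip_box \<alpha> \<beta> m l s)} = measure noise {s. P s}"
proof -
  have "measure noise {s. P s} = measure (distr noise noise (flip_box \<alpha> \<beta> m l)) {s. P s}"
    by (simp add: distr_flip_box[of \<alpha> \<beta>, OF assms(1,2)])
  also have "\<dots> = measure noise {s. P (flip_box \<alpha> \<beta> m l s)}"
    using A by (subst measure_distr) (auto simp: vimage_def)
  finally show ?thesis ..
qed

text \<open>The sums along the two edges are dependent. The deviation is split evenly between them, and a union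
  bound reduces it to the deviations of each sum.\<close>

lemma stationary_deviation:
  assumes pos: "\<And>i. 1 \<le> i \<Longrightarrow> 0 < \<alpha> i" "\<And>j. 1 \<le> j \<Longrightarrow> 0 < \<beta> j"
    and M: "0 < M" and \<delta>: "0 < \<delta>"
    and bound: "\<And>i. 1 \<le> i \<Longrightarrow> 1 / \<alpha> i \<le> M" "\<And>j. 1 \<le> j \<Longrightarrow> 1 / \<beta> j \<le> M"
    and sums: "(\<Sum>i=1..m. 1 / \<alpha> i) \<le> real n * M" "(\<Sum>j=1..l. 1 / \<beta> j) \<le> real n * M"
  shows "measure noise {s. real n * \<delta> \<le>
      \<bar>lpp (stat_weight \<alpha> \<beta> s) m l - ((\<Sum>i=1..m. 1 / \<alpha> i) + (\<Sum>j=1..l. 1 / \<beta> j))\<bar>}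
    \<le> 4 * exp (- (min (1 / (2 * M)) (\<delta> / 2 / (4 * M\<^sup>2)) * (\<delta> / 2) / 2 * real n))"
    (is "?L \<le> 4 * ?e")
proof -
  interpret prob_space noise by (rule prob_space_noise)
  let ?X = "\<lambda>s. \<bar>(\<Sum>i=1..m. 1 / \<alpha> i * s (i, 0)) - (\<Sum>i=1..m. 1 / \<alpha> i)\<bar>"
  let ?Y = "\<lambda>s. \<bar>(\<Sum>j=1..l. 1 / \<beta> j * s (0, j)) - (\<Sum>j=1..l. 1 / \<beta> j)\<bar>"
  let ?f = "flip_box \<alpha> \<beta> m l"
  have X: "measure noise {s. real n * (\<delta> / 2) \<le> ?X s} \<le> 2 * ?e"
    by (rule noise_family_deviation) (use M \<delta> sums bound pos in \<open>auto simp: inj_on_def less_imp_le\<close>)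
  have Y: "measure noise {s. real n * (\<delta> / 2) \<le> ?Y s} \<le> 2 * ?e"
    by (rule noise_family_deviation) (use M \<delta> sums bound pos in \<open>auto simp: inj_on_def less_imp_le\<close>)
  have "{s \<in> space noise. real n * (\<delta> / 2) \<le> ?X s} \<in> events" "{s \<in> space noise. real n * (\<delta> / 2) \<le> ?Y s} \<in> events"
    "{s \<in> space noise. real n * (\<delta> / 2) \<le> ?Y (?f s)} \<in> events"
  proof -
    show "{s \<in> space noise. real n * (\<delta> / 2) \<le> ?X s} \<in> events" by measurable
    show Y[measurable]: "{s \<in> space noise. real n * (\<delta> / 2) \<le> ?Y s} \<in> events" by measurable
    show "{s \<in> space noise. real n * (\<delta> / 2) \<le> ?Y (?f s)} \<in> events"
      using measurable_sets[OF measurable_flip_box Y, of \<alpha> \<beta> m l] by (simp add: vimage_def)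
  qed
  then have meas: "{s. real n * (\<delta> / 2) \<le> ?X s} \<in> events" "{s. real n * (\<delta> / 2) \<le> ?Y s} \<in> events"
    "{s. real n * (\<delta> / 2) \<le> ?Y (?f s)} \<in> events" by simp_all
  have eq: "lpp (stat_weight \<alpha> \<beta> s) m l = (\<Sum>i=1..m. 1 / \<alpha> i * s (i, 0)) + (\<Sum>j=1..l. 1 / \<beta> j * ?f s (0, j))" for s
    by (simp add: stationary_lpp_eq_sums[of \<alpha> \<beta>, OF pos])
  have "{s. real n * \<delta> \<le> \<bar>lpp (stat_weight \<alpha> \<beta> s) m l - ((\<Sum>i=1..m. 1 / \<alpha> i) + (\<Sum>j=1..l. 1 / \<beta> j))\<bar>} \<subseteq>
      {s. real n * (\<delta> / 2) \<le> ?X s} \<union> {s. real n * (\<delta> / 2) \<le> ?Y (?f s)}"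
  proof -
    have "real n * (\<delta> / 2) \<le> \<bar>x - p\<bar> \<or> real n * (\<delta> / 2) \<le> \<bar>y - q\<bar>"
      if "real n * \<delta> \<le> \<bar>(x + y) - (p + q)\<bar>" for x y p q
      using that by (simp add: abs_if split: if_splits; linarith)
    then show ?thesis unfolding eq by blast
  qed
  then have "?L \<le> measure noise ({s. real n * (\<delta> / 2) \<le> ?X s} \<union> {s. real n * (\<delta> / 2) \<le> ?Y (?f s)})"
    using meas by (intro finite_measure_mono) auto
  also have "\<dots> \<le> measure noise {s. real n * (\<delta> / 2) \<le> ?X s} + measure noise {s. real n * (\<delta> / 2) \<le> ?Y (?f s)}"
    using meas by (intro measure_Un_le)
  also have "measure noise {s. real n * (\<delta> / 2) \<le> ?Y (?f s)} = measure noise {s. real n * (\<delta> / 2) \<le> ?Y s}"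
    by (rule measure_noise_flip_box) (use pos meas in auto)
  finally show ?thesis using X Y by simp
qed

lemma AE_noise_eventually:
  assumes A: "\<And>n. {s. P n s} \<in> sets noise" and \<kappa>: "0 < \<kappa>"
    and bound: "\<And>n. 1 \<le> n \<Longrightarrow> measure noise {s. P n s} \<le> C * exp (- (\<kappa> * real n))"
  shows "AE s in noise. eventually (\<lambda>n. \<not> P n s) sequentially"
proof -
  interpret prob_space noise by (rule prob_space_noise)
  have "summable (\<lambda>n. C * exp (- \<kappa>) ^ n)"
    using \<kappa> by (intro summable_mult summable_geometric) simp
  then have "summable (\<lambda>n. measure noise {s. P n s})"
  proof (rule summable_comparison_test_ev[rotated])
    show "eventually (\<lambda>n. norm (measure noise {s. P n s}) \<le> C * exp (- \<kappa>) ^ n) sequentially"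
      using eventually_ge_at_top[of 1]
      by eventually_elim (use bound in \<open>auto simp: exp_of_nat_mult[symmetric] mult.commute\<close>)
  qed
  then show ?thesis
    using borel_cantelli_AE1[of "\<lambda>n. {s. P n s}" noise] A
    by (auto simp: emeasure_eq_measure)
qed

lemma AE_noise_tendsto:
  fixes X :: "nat \<Rightarrow> (nat \<times> nat \<Rightarrow> real) \<Rightarrow> real"
  assumes [measurable]: "\<And>n. X n \<in> borel_measurable noise"
    and bound: "\<And>\<delta>. 0 < \<delta> \<Longrightarrow> \<exists>\<kappa>>0. \<exists>C. \<forall>n\<ge>1.
      measure noise {s. real n * \<delta> \<le> \<bar>X n s - real n * \<mu>\<bar>} \<le> C * exp (- (\<kappa> * real n))"
  shows "AE s in noise. (\<lambda>n. X n s / real n) \<longlonglongrightarrow> \<mu>"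
proof -
  have "AE s in noise. \<forall>r. eventually (\<lambda>n. \<not> real n * (1 / real (Suc r)) \<le> \<bar>X n s - real n * \<mu>\<bar>) sequentially"
    unfolding AE_all_countable
  proof
    fix r
    obtain \<kappa> C where "0 < \<kappa>" "\<And>n. 1 \<le> n \<Longrightarrow>
        measure noise {s. real n * (1 / real (Suc r)) \<le> \<bar>X n s - real n * \<mu>\<bar>} \<le> C * exp (- (\<kappa> * real n))"
      using bound[of "1 / real (Suc r)"] by auto
    moreover have "{s \<in> space noise. real n * (1 / real (Suc r)) \<le> \<bar>X n s - real n * \<mu>\<bar>} \<in> sets noise" for n
      by measurable
    then have "{s. real n * (1 / real (Suc r)) \<le> \<bar>X n s - real n * \<mu>\<bar>} \<in> sets noise" for n
      by simp
    ultimately show "AE s in noise. eventually (\<lambda>n. \<not> real n * (1 / real (Suc r)) \<le> \<bar>X n s - real n * \<mu>\<bar>) sequentially"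
      by (intro AE_noise_eventually)
  qed
  then show ?thesis
  proof eventually_elim
    case (elim s)
    show ?case
    proof (rule tendstoI)
      fix e :: real assume "0 < e"
      then obtain r where r: "inverse (real (Suc r)) < e" using reals_Archimedean by blast
      show "eventually (\<lambda>n. dist (X n s / real n) \<mu> < e) sequentially"
        using elim[rule_format, of r] eventually_gt_at_top[of 0]
      proof eventually_elim
        case (elim n)
        have "X n s / real n - \<mu> = (X n s - real n * \<mu>) / real n"
          using elim by (simp add: diff_divide_distrib)
        then have "\<bar>X n s / real n - \<mu>\<bar> = \<bar>X n s - real n * \<mu>\<bar> / real n"
          by simp
        also have "\<dots> < inverse (real (Suc r))"
          using elim by (simp add: field_simps)
        finally show ?case using r by (simp add: dist_real_def)
      qed
    qed
  qed
qed

lemma AE_noise_nonneg: "AE s in noise. \<forall>e. 0 \<le> s e"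
proof -
  have "AE x in exp_distr 1. 0 \<le> x"
    by (subst AE_density) (auto simp: exponential_density_def)
  then have "AE s in noise. 0 \<le> s e" for e
    unfolding noise_def
    by (intro AE_PiM_component) (auto intro: prob_space_exponential_density)
  then show ?thesis by (simp add: AE_all_countable)
qed

section \<open>The variational problem\<close>

definition head_sum :: "(nat \<Rightarrow> real) \<Rightarrow> (nat \<Rightarrow> real) \<Rightarrow> nat \<Rightarrow> real \<Rightarrow> real" where
  "head_sum a b k z = (\<Sum>i=1..k. 1 / (a i + z)) + (\<Sum>j=1..k. 1 / (b j - z))"

text \<open>Since \<open>x i\<close> tends to infinity, only finitely many terms lie below \<open>x 1\<close>.\<close>

lemma attained_of_tendsto_zero:
  fixes x :: "nat \<Rightarrow> real"
  assumes lim: "(\<lambda>i. 1 / (x (Suc i) + z)) \<longlonglongrightarrow> 0" and pos: "\<And>i. 1 \<le> i \<Longrightarrow> 0 < x i + z"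
  shows "\<exists>i\<ge>1. inf_seq x = ereal (x i)"
proof -
  have "0 < 1 / (x 1 + z)" using pos[of 1] by simp
  then have "eventually (\<lambda>i. 1 / (x (Suc i) + z) < 1 / (x 1 + z)) sequentially"
    using lim by (rule order_tendstoD(2)[rotated])
  then obtain N where N: "\<And>i. N \<le> i \<Longrightarrow> 1 / (x (Suc i) + z) < 1 / (x 1 + z)"
    by (auto simp: eventually_sequentially)
  have far: "x 1 \<le> x i" if "Suc N \<le> i" for i
  proof -
    obtain j where "i = Suc j" "N \<le> j" using \<open>Suc N \<le> i\<close> by (metis Suc_le_D Suc_le_mono)
    then show ?thesis using N[of j] pos[of 1] pos[of i] by (simp add: field_simps)
  qed
  define i where "i = arg_min_on x {1..Suc N}"
  have i: "i \<in> {1..Suc N}" "\<And>j. j \<in> {1..Suc N} \<Longrightarrow> x i \<le> x j"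
    unfolding i_def by (auto intro: arg_min_if_finite(1) arg_min_least)
       (use arg_min_if_finite(1)[of "{1..Suc N}" x] in auto)
  have "x i \<le> x j" if "1 \<le> j" for j
    using i(2)[of j] far[of j] i(2)[of 1] that by (cases "j \<le> Suc N") auto
  then have "inf_seq x = ereal (x i)"
    unfolding inf_seq_def using i(1) by (intro antisym INF_lower INF_greatest) auto
  with i(1) show ?thesis by auto
qed

text \<open>The hypotheses of the theorem on the rates, with the strip written as the real interval from \<open>p\<close> to \<open>q\<close>.\<close>

locale summable_rates =
  fixes a b :: "nat \<Rightarrow> real" and p q :: real
  assumes pq: "p < q" and inf_a: "inf_seq a = ereal (- p)" and inf_b: "inf_seq b = ereal q"
    and M_finite: "\<And>z. p < z \<Longrightarrow> z < q \<Longrightarrow> M_z a b z < \<infinity>"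
begin

lemma a_ge: "1 \<le> i \<Longrightarrow> - p \<le> a i"
proof -
  assume "1 \<le> i"
  then have "inf_seq a \<le> ereal (a i)" unfolding inf_seq_def by (intro INF_lower) auto
  then show ?thesis by (simp add: inf_a)
qed

lemma b_ge: "1 \<le> j \<Longrightarrow> q \<le> b j"
proof -
  assume "1 \<le> j"
  then have "inf_seq b \<le> ereal (b j)" unfolding inf_seq_def by (intro INF_lower) auto
  then show ?thesis by (simp add: inf_b)
qed

lemma rate_pos:
  assumes "p < z" "z < q" "1 \<le> i"
  shows "0 < a i + z" "0 < b i - z"
  using a_ge[of i] b_ge[of i] assms by auto

lemma sum_rate_pos: "1 \<le> i \<Longrightarrow> 1 \<le> j \<Longrightarrow> 0 < a i + b j"
  using a_ge[of i] b_ge[of j] pq by auto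

lemma strip_eq: "strip a b = {p<..<q}"
  by (auto simp: strip_def inf_a inf_b)

lemma head_sum_mono:
  assumes "p < z" "z < q" "k \<le> l"
  shows "head_sum a b k z \<le> head_sum a b l z"
  unfolding head_sum_def using assms rate_pos[OF assms(1,2)]
  by (intro add_mono sum_mono2) (auto simp: less_imp_le)

lemma head_sum_ge:
  assumes "p < z" "z < q" "1 \<le> i" "i \<le> k"
  shows "1 / (a i + z) \<le> head_sum a b k z" "1 / (b i - z) \<le> head_sum a b k z"
proof -
  have nonneg: "0 \<le> 1 / (a i + z)" "0 \<le> 1 / (b i - z)" if "1 \<le> i" for i
    using rate_pos[OF assms(1,2) that] by auto
  have "1 / (a i + z) \<le> (\<Sum>i=1..k. 1 / (a i + z))" "1 / (b i - z) \<le> (\<Sum>i=1..k. 1 / (b i - z))"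
    using assms nonneg by (auto intro!: member_le_sum)
  moreover have "0 \<le> (\<Sum>i=1..k. 1 / (a i + z))" "0 \<le> (\<Sum>i=1..k. 1 / (b i - z))"
    using nonneg by (auto intro!: sum_nonneg)
  ultimately show "1 / (a i + z) \<le> head_sum a b k z" "1 / (b i - z) \<le> head_sum a b k z"
    unfolding head_sum_def by linarith+
qed

lemma head_sum_tendsto:
  assumes "p < z" "z < q"
  shows "(\<lambda>k. ereal (head_sum a b k z)) \<longlonglongrightarrow> M_z a b z"
proof -
  have pos: "0 \<le> 1 / (a (Suc i) + z)" "0 \<le> 1 / (b (Suc i) - z)" for i
    using rate_pos[OF assms, of "Suc i"] by auto
  have "(\<lambda>k. \<Sum>i<k. ereal (1 / (a (Suc i) + z))) \<longlonglongrightarrow> (\<Sum>i. ereal (1 / (a (Suc i) + z)))"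
    "(\<lambda>k. \<Sum>i<k. ereal (1 / (b (Suc i) - z))) \<longlonglongrightarrow> (\<Sum>i. ereal (1 / (b (Suc i) - z)))"
    using pos by (intro summable_LIMSEQ summable_ereal_pos; simp)+
  moreover have "0 \<le> (\<Sum>i. ereal (1 / (a (Suc i) + z)))" "0 \<le> (\<Sum>i. ereal (1 / (b (Suc i) - z)))"
    using pos by (intro suminf_0_le; simp)+
  ultimately have "(\<lambda>k. (\<Sum>i<k. ereal (1 / (a (Suc i) + z))) + (\<Sum>i<k. ereal (1 / (b (Suc i) - z)))) \<longlonglongrightarrow> M_z a b z"
    unfolding M_z_def by (intro tendsto_add_ereal_general) auto
  then show ?thesis
    by (simp add: head_sum_def sum.atLeast1_atMost_eq)
qed

lemma M_z_eq_real:
  assumes "p < z" "z < q"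
  obtains m where "M_z a b z = ereal m" "\<And>k. head_sum a b k z \<le> m" "0 < m"
proof -
  have le: "ereal (head_sum a b k z) \<le> M_z a b z" for k
    by (rule incseq_le[OF _ head_sum_tendsto[OF assms]]) (auto simp: incseq_def head_sum_mono[OF assms])
  have "M_z a b z \<noteq> \<infinity>" "M_z a b z \<noteq> - \<infinity>"
    using M_finite[OF assms] le[of 0] by auto
  then obtain m where m: "M_z a b z = ereal m" by (cases "M_z a b z") auto
  have "0 < 1 / (a 1 + z)" using rate_pos[OF assms, of 1] by simp
  also have "\<dots> \<le> head_sum a b 1 z" by (rule head_sum_ge) (use assms in auto)
  also have "\<dots> \<le> m" using le[of 1] m by simp
  finally show ?thesis using le m that by auto
qed

text \<open>This makes every truncation that contains the two minimizing indices blow up at both ends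
  of the same strip, so that the truncations have minimizers inside it.\<close>

lemma infima_attained:
  obtains i j where "1 \<le> i" "a i = - p" "1 \<le> j" "b j = q"
proof -
  define z where "z = (p + q) / 2"
  have z: "p < z" "z < q" using pq by (auto simp: z_def)
  obtain m where m: "\<And>k. head_sum a b k z \<le> m"
    using M_z_eq_real[OF z] by metis
  have nonneg: "0 \<le> 1 / (a (Suc i) + z)" "0 \<le> 1 / (b (Suc i) - z)" for i
    using rate_pos[OF z, of "Suc i"] by auto
  have head: "head_sum a b k z = (\<Sum>i<k. 1 / (a (Suc i) + z)) + (\<Sum>i<k. 1 / (b (Suc i) - z))" for k
    by (simp add: head_sum_def sum.atLeast1_atMost_eq)
  have "(\<Sum>i<k. 1 / (a (Suc i) + z)) \<le> m" "(\<Sum>i<k. 1 / (b (Suc i) - z)) \<le> m" for k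
    using m[of k] sum_nonneg[of "{..<k}" "\<lambda>i. 1 / (a (Suc i) + z)"] sum_nonneg[of "{..<k}" "\<lambda>i. 1 / (b (Suc i) - z)"] nonneg
    unfolding head by (smt (verit))+
  then have "summable (\<lambda>i. 1 / (a (Suc i) + z))" "summable (\<lambda>i. 1 / (b (Suc i) - z))"
    using nonneg by (blast intro: summableI_nonneg_bounded)+
  then have "\<exists>i\<ge>1. inf_seq a = ereal (a i)" "\<exists>j\<ge>1. inf_seq b = ereal (b j)"
    using rate_pos[OF z] attained_of_tendsto_zero[of a z] attained_of_tendsto_zero[of b "- z"]
    by (auto dest!: summable_LIMSEQ_zero)
  then show ?thesis using that inf_a inf_b by auto
qed

lemma has_real_derivative_head_sum:
  assumes "p < z" "z < q"
  shows "(head_sum a b k has_real_derivative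
    (\<Sum>i=1..k. - (1 / (a i + z)\<^sup>2)) + (\<Sum>j=1..k. 1 / (b j - z)\<^sup>2)) (at z)"
proof -
  have "((\<lambda>z. 1 / (a i + z)) has_real_derivative - (1 / (a i + z)\<^sup>2)) (at z)"
    "((\<lambda>z. 1 / (b i - z)) has_real_derivative 1 / (b i - z)\<^sup>2) (at z)" if "1 \<le> i" for i
    using rate_pos[OF assms that] by (auto intro!: derivative_eq_intros simp: power2_eq_square)
  then have "((\<lambda>z. (\<Sum>i=1..k. 1 / (a i + z)) + (\<Sum>j=1..k. 1 / (b j - z))) has_real_derivative
    (\<Sum>i=1..k. - (1 / (a i + z)\<^sup>2)) + (\<Sum>j=1..k. 1 / (b j - z)\<^sup>2)) (at z)"
    by (intro DERIV_add DERIV_sum) auto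
  then show ?thesis by (simp add: head_sum_def[abs_def])
qed

lemma continuous_on_head_sum: "continuous_on {p<..<q} (head_sum a b k)"
  using has_real_derivative_head_sum
  by (intro DERIV_continuous_on) (auto intro: has_field_derivative_at_within)

lemma head_sum_minimizer:
  assumes i0: "1 \<le> i0" "a i0 = - p" "i0 \<le> k" and j0: "1 \<le> j0" "b j0 = q" "j0 \<le> k"
  obtains z where "p < z" "z < q" "\<And>y. p < y \<Longrightarrow> y < q \<Longrightarrow> head_sum a b k z \<le> head_sum a b k y"
proof -
  define y where "y = (p + q) / 2"
  \<comment> \<open>Within distance \<open>h\<close> of an end of the strip, a single term already exceeds the value at the midpoint \<open>y\<close>.\<close>
  define R where "R = head_sum a b k y + 1"
  define h where "h = min (1 / R) ((q - p) / 2)"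
  have y: "p < y" "y < q" using pq by (auto simp: y_def)
  have "0 < 1 / (a i0 + y)" using rate_pos[OF y i0(1)] by simp
  also have "\<dots> \<le> head_sum a b k y" by (rule head_sum_ge(1)[OF y i0(1,3)])
  finally have R: "1 < R" by (simp add: R_def)
  have h: "0 < h" "h \<le> 1 / R" "p + h \<le> y" "y \<le> q - h"
    using R pq by (auto simp: h_def y_def min_def field_simps)
  have "continuous_on {p + h..q - h} (head_sum a b k)"
    by (rule continuous_on_subset[OF continuous_on_head_sum]) (use h in auto)
  then obtain z where z: "z \<in> {p + h..q - h}" "\<And>x. x \<in> {p + h..q - h} \<Longrightarrow> head_sum a b k z \<le> head_sum a b k x"
    using continuous_attains_inf[of "{p + h..q - h}" "head_sum a b k"] h by fastforce
  have outside: "head_sum a b k z \<le> head_sum a b k x" if x: "p < x" "x < q" "x \<notin> {p + h..q - h}" for x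
  proof -
    have "x - p < h \<or> q - x < h" using x by auto
    moreover have "R \<le> 1 / t" if "0 < t" "t < h" for t
    proof -
      have "t * R \<le> h * R" using that R by (intro mult_right_mono) auto
      also have "\<dots> \<le> 1" using h(2) R by (simp add: field_simps)
      finally show ?thesis using that by (simp add: field_simps)
    qed
    ultimately have "R \<le> 1 / (x - p) \<or> R \<le> 1 / (q - x)" using x by auto
    then have "R \<le> head_sum a b k x"
      using head_sum_ge(1)[OF x(1,2) i0(1,3)] head_sum_ge(2)[OF x(1,2) j0(1,3)] i0 j0 by auto
    moreover have "head_sum a b k z \<le> head_sum a b k y" using z(2) h by auto
    ultimately show ?thesis by (simp add: R_def)
  qed
  show ?thesis
  proof (rule that)
    show "p < z" "z < q" using z(1) h by auto
    show "head_sum a b k z \<le> head_sum a b k x" if "p < x" "x < q" for x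
      using z(2) outside that by blast
  qed
qed

text \<open>If all truncations had minimum at most \<open>c\<close>, their sublevel sets for \<open>c\<close> would be nonempty, decreasing
  and contained in a fixed compact part of the strip. A common point \<open>x\<close> would give \<open>M_z a b x \<le> c\<close>.\<close>

lemma large_minimum:
  assumes c: "ereal c < M_inf a b"
  obtains k z where "p < z" "z < q" "c < head_sum a b k z"
    "\<And>y. p < y \<Longrightarrow> y < q \<Longrightarrow> head_sum a b k z \<le> head_sum a b k y"
proof -
  obtain i0 j0 where i0: "1 \<le> i0" "a i0 = - p" and j0: "1 \<le> j0" "b j0 = q"
    by (rule infima_attained)
  define k0 where "k0 = max i0 j0"
  have "\<exists>z. p < z \<and> z < q \<and> (\<forall>y. p < y \<longrightarrow> y < q \<longrightarrow> head_sum a b (k0 + n) z \<le> head_sum a b (k0 + n) y)" for n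
  proof -
    have "i0 \<le> k0 + n" "j0 \<le> k0 + n" by (auto simp: k0_def)
    then show ?thesis using head_sum_minimizer[OF i0 _ j0, of "k0 + n"] by metis
  qed
  then obtain z where z: "\<And>n. p < z n" "\<And>n. z n < q"
    "\<And>n y. p < y \<Longrightarrow> y < q \<Longrightarrow> head_sum a b (k0 + n) (z n) \<le> head_sum a b (k0 + n) y"
    by metis
  have "\<exists>n. c < head_sum a b (k0 + n) (z n)"
  proof (rule ccontr)
    assume "\<not> ?thesis"
    then have le: "head_sum a b (k0 + n) (z n) \<le> c" for n by (simp add: not_less)
    have near: "1 / (x - p) \<le> head_sum a b (k0 + n) x" "1 / (q - x) \<le> head_sum a b (k0 + n) x"
      if "p < x" "x < q" for x n
      using head_sum_ge(1)[OF that i0(1), of "k0 + n"] head_sum_ge(2)[OF that j0(1), of "k0 + n"] i0 j0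
      by (auto simp: k0_def)
    have "0 < 1 / (z 0 - p)" using z by simp
    then have c0: "0 < c" using near(1)[of "z 0" 0] le[of 0] z by (smt (verit))
    define h where "h = 1 / c"
    have h: "0 < h" using c0 by (simp add: h_def)
    define C where "C n = {p + h..q - h} \<inter> head_sum a b (k0 + n) -` {..c}" for n
    have zC: "z n \<in> C n" for n
    proof -
      have "1 / (z n - p) \<le> c" "1 / (q - z n) \<le> c"
        using near[OF z(1)[of n] z(2)[of n], of n] le[of n] by linarith+
      then have "h \<le> z n - p" "h \<le> q - z n"
        using c0 z(1)[of n] z(2)[of n] by (simp_all add: h_def field_simps)
      then show ?thesis using le[of n] by (simp add: C_def)
    qed
    have sub: "{p + h..q - h} \<subseteq> {p<..<q}" using h by auto
    have "compact (C n)" for n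
      unfolding C_def compact_eq_bounded_closed
      by (intro conjI bounded_Int disjI1 bounded_closed_interval continuous_closed_preimage
          continuous_on_subset[OF continuous_on_head_sum sub]) auto
    moreover have "C n \<noteq> {}" for n using zC by auto
    moreover have "C n \<subseteq> C m" if "m \<le> n" for m n
      using that sub head_sum_mono[of _ "k0 + m" "k0 + n"] by (fastforce simp: C_def)
    ultimately have "\<Inter> (range C) \<noteq> {}" by (rule compact_nest)
    then obtain x where x: "\<And>n. x \<in> C n" by auto
    have "x \<in> {p + h..q - h}" using x[of 0] by (simp add: C_def)
    with sub have xpq: "p < x" "x < q" by auto
    have "head_sum a b n x \<le> c" for n
      using x[of n] head_sum_mono[OF xpq, of n "k0 + n"] by (auto simp: C_def)
    then have "M_z a b x \<le> ereal c"
      by (intro LIMSEQ_le_const2[OF head_sum_tendsto[OF xpq]]) auto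
    moreover have "M_inf a b \<le> M_z a b x"
      unfolding M_inf_def by (intro INF_lower) (use xpq in \<open>auto simp: strip_eq\<close>)
    ultimately show False using c by (meson leD order_trans)
  qed
  then show ?thesis using z that by blast
qed

text \<open>At the minimizer the derivative of \<open>head_sum a b k\<close> vanishes, whereas \<open>1 / (a 1 + y)\<close> is strictly decreasing
  and \<open>1 / (b 1 - y)\<close> strictly increasing in \<open>y\<close>. So, to first order, a small shift gains on the axis more
  than it costs in \<open>head_sum a b k\<close>.\<close>

lemma perturbations_at_minimum:
  assumes z: "p < z" "z < q" and min: "\<And>y. p < y \<Longrightarrow> y < q \<Longrightarrow> head_sum a b k z \<le> head_sum a b k y"
    and \<epsilon>: "0 < \<epsilon>"
  obtains \<eta>\<^sub>1 \<eta>\<^sub>2 where "0 < \<eta>\<^sub>1" "p < z - \<eta>\<^sub>1" "0 < \<eta>\<^sub>2" "z + \<eta>\<^sub>2 < q"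
    "head_sum a b k (z - \<eta>\<^sub>1) - \<epsilon> * (1 / (a 1 + (z - \<eta>\<^sub>1)) - 1 / (a 1 + z)) < head_sum a b k z"
    "head_sum a b k (z + \<eta>\<^sub>2) - \<epsilon> * (1 / (b 1 - (z + \<eta>\<^sub>2)) - 1 / (b 1 - z)) < head_sum a b k z"
proof -
  let ?d = "(\<Sum>i=1..k. - (1 / (a i + z)\<^sup>2)) + (\<Sum>j=1..k. 1 / (b j - z)\<^sup>2)"
  have der: "(head_sum a b k has_real_derivative ?d) (at z)" by (rule has_real_derivative_head_sum[OF z])
  have "?d = 0"
  proof (rule DERIV_local_min[OF der])
    show "0 < min (z - p) (q - z)" using z by simp
    show "\<forall>y. \<bar>z - y\<bar> < min (z - p) (q - z) \<longrightarrow> head_sum a b k z \<le> head_sum a b k y"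
      using min by (auto simp: abs_if split: if_splits)
  qed
  with der have der0: "(head_sum a b k has_real_derivative 0) (at z)" by simp
  have pos: "0 < a 1 + z" "0 < b 1 - z" using rate_pos[OF z, of 1] by auto
  define f where "f y = head_sum a b k y - \<epsilon> / (a 1 + y)" for y
  define g where "g y = head_sum a b k y - \<epsilon> / (b 1 - y)" for y
  have "(f has_real_derivative 0 - (- (\<epsilon> / (a 1 + z)\<^sup>2))) (at z)"
    unfolding f_def using pos
    by (intro DERIV_diff der0) (auto intro!: derivative_eq_intros simp: power2_eq_square)
  then have "\<exists>d>0. \<forall>h>0. h < d \<longrightarrow> f (z - h) < f z"
    by (rule DERIV_pos_inc_left) (use pos \<epsilon> in simp)
  then obtain d1 where d1: "0 < d1" "\<And>h. 0 < h \<Longrightarrow> h < d1 \<Longrightarrow> f (z - h) < f z"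
    by blast
  have "(g has_real_derivative 0 - (\<epsilon> / (b 1 - z)\<^sup>2)) (at z)"
    unfolding g_def using pos
    by (intro DERIV_diff der0) (auto intro!: derivative_eq_intros simp: power2_eq_square)
  then have "\<exists>d>0. \<forall>h>0. h < d \<longrightarrow> g (z + h) < g z"
    by (rule DERIV_neg_dec_right) (use pos \<epsilon> in simp)
  then obtain d2 where d2: "0 < d2" "\<And>h. 0 < h \<Longrightarrow> h < d2 \<Longrightarrow> g (z + h) < g z"
    by blast
  define \<eta>\<^sub>1 where "\<eta>\<^sub>1 = min d1 (z - p) / 2"
  define \<eta>\<^sub>2 where "\<eta>\<^sub>2 = min d2 (q - z) / 2"
  have \<eta>: "0 < \<eta>\<^sub>1" "\<eta>\<^sub>1 < d1" "p < z - \<eta>\<^sub>1" "0 < \<eta>\<^sub>2" "\<eta>\<^sub>2 < d2" "z + \<eta>\<^sub>2 < q"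
    using d1(1) d2(1) z by (auto simp: \<eta>\<^sub>1_def \<eta>\<^sub>2_def min_def field_simps)
  show ?thesis
  proof (rule that[OF \<eta>(1,3,4,6)])
    show "head_sum a b k (z - \<eta>\<^sub>1) - \<epsilon> * (1 / (a 1 + (z - \<eta>\<^sub>1)) - 1 / (a 1 + z)) < head_sum a b k z"
      using d1(2)[OF \<eta>(1,2)] by (simp add: f_def right_diff_distrib)
    show "head_sum a b k (z + \<eta>\<^sub>2) - \<epsilon> * (1 / (b 1 - (z + \<eta>\<^sub>2)) - 1 / (b 1 - z)) < head_sum a b k z"
      using d2(2)[OF \<eta>(4,5)] by (simp add: g_def right_diff_distrib)
  qed
qed

end

section \<open>Almost sure bounds for the block-scaled model\<close>

text \<open>For \<open>1 \<le> i\<close> and \<open>0 < n\<close> this is the ceiling of \<open>i / n\<close>. The value at \<open>i = 0\<close> is \<open>1\<close>, so that every rate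
  \<open>a (block n i)\<close> is subject to the bounds for positive indices.\<close>

definition block :: "nat \<Rightarrow> nat \<Rightarrow> nat" where
  "block n i = Suc ((i - 1) div n)"

lemma block_ge_1: "1 \<le> block n i"
  by (simp add: block_def)

lemma block_eq_1: "0 < n \<Longrightarrow> i \<le> n \<Longrightarrow> block n i = 1"
  by (simp add: block_def)

lemma nat_ceiling_eq_block:
  assumes "0 < n" "1 \<le> i"
  shows "nat \<lceil>real i / real n\<rceil> = block n i"
proof -
  obtain m where i: "i = Suc m" using assms(2) by (cases i) auto
  have "m div n * n \<le> m" "m < Suc (m div n) * n"
    using assms(1) dividend_less_div_times[of n m] by (auto simp: add.commute)
  then have "real (m div n * n) < real i" "real i \<le> real (Suc (m div n) * n)"
    unfolding i by linarith+
  then have "real (m div n) < real i / real n" "real i / real n \<le> real (Suc (m div n))"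
    using assms(1) by (simp_all only: of_nat_mult pos_less_divide_eq pos_divide_le_eq of_nat_0_less_iff)
  then have "\<lceil>real i / real n\<rceil> = int (Suc (m div n))"
    by (intro ceiling_unique) auto
  then show ?thesis by (simp add: block_def i)
qed

lemma sum_block:
  assumes "0 < n"
  shows "(\<Sum>i=1..n * k. f (block n i)) = real n * (\<Sum>i=1..k. f i)"
proof (induction k)
  case (Suc k)
  have "{1..n * Suc k} = {1..n * k} \<union> {Suc (n * k)..n * k + n}" by auto
  then have "(\<Sum>i=1..n * Suc k. f (block n i)) =
      (\<Sum>i=1..n * k. f (block n i)) + (\<Sum>i=Suc (n * k)..n * k + n. f (block n i))"
    by (simp add: sum.union_disjoint)
  also have "(\<Sum>i=Suc (n * k)..n * k + n. f (block n i)) = (\<Sum>i=Suc (n * k)..n * k + n. f (Suc k))"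
  proof (intro sum.cong refl)
    fix i assume "i \<in> {Suc (n * k)..n * k + n}"
    then have "(i - 1) div n = k"
      using assms by (intro div_nat_eqI) auto
    then show "f (block n i) = f (Suc k)" by (simp add: block_def)
  qed
  finally show ?case using Suc by (simp add: algebra_simps)
qed simp

context summable_rates
begin

definition boundary_lpp :: "nat \<Rightarrow> real \<Rightarrow> nat \<Rightarrow> (nat \<times> nat \<Rightarrow> real) \<Rightarrow> real" where
  "boundary_lpp n z k s = lpp (stat_weight (\<lambda>i. a (block n i) + z) (\<lambda>j. b (block n j) - z) s) (n * k) (n * k)"

definition bulk_weight :: "nat \<Rightarrow> (nat \<times> nat \<Rightarrow> real) \<Rightarrow> nat \<Rightarrow> nat \<Rightarrow> real" where
  "bulk_weight n s = off_axes (\<lambda>i j. s (i, j) / (a (block n i) + b (block n j)))"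

lemma off_axes_stat_weight:
  "off_axes (stat_weight (\<lambda>i. a (block n i) + z) (\<lambda>j. b (block n j) - z) s) = bulk_weight n s"
  by (auto simp: off_axes_def stat_weight_def bulk_weight_def fun_eq_iff)

lemma bulk_weight_nonneg:
  assumes "\<And>e. 0 \<le> s e"
  shows "0 \<le> bulk_weight n s i j"
  using assms sum_rate_pos[OF block_ge_1[of n i] block_ge_1[of n j]]
  by (simp add: bulk_weight_def off_axes_def)

lemma stat_weight_nonneg:
  assumes "p < z" "z < q" "\<And>e. 0 \<le> s e"
  shows "0 \<le> stat_weight (\<lambda>i. a (block n i) + z) (\<lambda>j. b (block n j) - z) s i j"
  using assms(3) rate_pos[OF assms(1,2) block_ge_1[of n i]] rate_pos[OF assms(1,2) block_ge_1[of n j]]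
    sum_rate_pos[OF block_ge_1[of n i] block_ge_1[of n j]] by (simp add: stat_weight_def)

lemma bulk_le_boundary_lpp:
  assumes "p < z" "z < q" "\<And>e. 0 \<le> s e"
  shows "lpp (bulk_weight n s) (n * k) (n * k) \<le> boundary_lpp n z k s"
  unfolding boundary_lpp_def off_axes_stat_weight[of n z s, symmetric]
  using stat_weight_nonneg[OF assms, of n] by (intro lpp_mono_weights) (simp add: off_axes_def)

lemma borel_measurable_boundary_lpp [measurable]: "boundary_lpp n z k \<in> borel_measurable noise"
  unfolding boundary_lpp_def[abs_def] by measurable

lemma borel_measurable_bulk_weight [measurable]: "(\<lambda>s. bulk_weight n s i j) \<in> borel_measurable noise"
  unfolding bulk_weight_def off_axes_def by measurable

text \<open>The total \<open>m\<close> of the series bounds every single coefficient as well as all truncated sums, hence the rate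
  is uniform in \<open>k\<close>. This uniformity is what controls the supremum over all boxes.\<close>

lemma boundary_lpp_deviation:
  assumes z: "p < z" "z < q" and m: "\<And>k. head_sum a b k z \<le> m" "0 < m" and \<delta>: "0 < \<delta>"
  shows "\<exists>\<kappa>>0. \<forall>n\<ge>1. \<forall>k. measure noise {s. real n * \<delta> \<le> \<bar>boundary_lpp n z k s - real n * head_sum a b k z\<bar>}
    \<le> 4 * exp (- (\<kappa> * real n))"
proof (intro exI conjI allI impI)
  let ?\<kappa> = "min (1 / (2 * m)) (\<delta> / 2 / (4 * m\<^sup>2)) * (\<delta> / 2) / 2"
  show "0 < ?\<kappa>" using m \<delta> by simp
  fix n k :: nat assume n: "1 \<le> n"
  let ?\<alpha> = "\<lambda>i. a (block n i) + z" and ?\<beta> = "\<lambda>j. b (block n j) - z"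
  have sums: "(\<Sum>i=1..n * k. 1 / ?\<alpha> i) = real n * (\<Sum>i=1..k. 1 / (a i + z))"
    "(\<Sum>j=1..n * k. 1 / ?\<beta> j) = real n * (\<Sum>j=1..k. 1 / (b j - z))"
    using sum_block[of n "\<lambda>i. 1 / (a i + z)" k] sum_block[of n "\<lambda>j. 1 / (b j - z)" k] n by auto
  then have total: "(\<Sum>i=1..n * k. 1 / ?\<alpha> i) + (\<Sum>j=1..n * k. 1 / ?\<beta> j) = real n * head_sum a b k z"
    by (simp add: head_sum_def distrib_left)
  have pos: "0 < 1 / (a i + z)" "0 < 1 / (b i - z)" if "1 \<le> i" for i
    using rate_pos[OF z that] by auto
  have "0 \<le> (\<Sum>i=1..k. 1 / (a i + z))" "0 \<le> (\<Sum>j=1..k. 1 / (b j - z))"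
    using pos by (auto intro!: sum_nonneg intro: less_imp_le)
  with m(1)[of k] have "(\<Sum>i=1..k. 1 / (a i + z)) \<le> m" "(\<Sum>j=1..k. 1 / (b j - z)) \<le> m"
    unfolding head_sum_def by linarith+
  then have sums_le: "(\<Sum>i=1..n * k. 1 / ?\<alpha> i) \<le> real n * m" "(\<Sum>j=1..n * k. 1 / ?\<beta> j) \<le> real n * m"
    unfolding sums by (auto intro: mult_left_mono)
  have bound: "1 / ?\<alpha> i \<le> m" "1 / ?\<beta> i \<le> m" for i
    using head_sum_ge[OF z block_ge_1[of n i] order_refl] m(1)[of "block n i"] by linarith+
  have pos': "0 < ?\<alpha> i" "0 < ?\<beta> i" for i
    using rate_pos[OF z block_ge_1[of n i]] by auto
  show "measure noise {s. real n * \<delta> \<le> \<bar>boundary_lpp n z k s - real n * head_sum a b k z\<bar>} \<le> 4 * exp (- (?\<kappa> * real n))"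
    using stationary_deviation[of ?\<alpha> ?\<beta> m \<delta> "n * k" n "n * k", OF pos' m(2) \<delta> bound sums_le]
    unfolding total boundary_lpp_def by simp
qed

lemma AE_boundary_lpp_tendsto:
  assumes z: "p < z" "z < q"
  shows "AE s in noise. (\<lambda>n. boundary_lpp n z k s / real n) \<longlonglongrightarrow> head_sum a b k z"
proof (rule AE_noise_tendsto)
  fix \<delta> :: real assume "0 < \<delta>"
  obtain m where "\<And>k. head_sum a b k z \<le> m" "0 < m" using M_z_eq_real[OF z] by metis
  from boundary_lpp_deviation[OF z this \<open>0 < \<delta>\<close>]
  show "\<exists>\<kappa>>0. \<exists>C. \<forall>n\<ge>1. measure noise {s. real n * \<delta> \<le> \<bar>boundary_lpp n z k s - real n * head_sum a b k z\<bar>}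
      \<le> C * exp (- (\<kappa> * real n))"
    by blast
qed measurable

text \<open>On nonnegative noise the events for the boxes of side \<open>n * k\<close> increase with \<open>k\<close>, so their union
  inherits the uniform bound on their probabilities.\<close>

lemma AE_bulk_upper:
  assumes c: "M_inf a b < ereal c"
  shows "AE s in noise. eventually (\<lambda>n. \<forall>i j. lpp (bulk_weight n s) i j \<le> real n * c) sequentially"
proof -
  interpret prob_space noise by (rule prob_space_noise)
  obtain z where z: "p < z" "z < q" "M_z a b z < ereal c"
    using c unfolding M_inf_def by (auto simp: INF_less_iff strip_eq)
  obtain m where m: "M_z a b z = ereal m" "\<And>k. head_sum a b k z \<le> m" "0 < m"
    using M_z_eq_real[OF z(1,2)] by metis
  have mc: "0 < c - m" using z(3) m(1) by simp
  obtain \<kappa> where \<kappa>: "0 < \<kappa>" "\<And>n k. 1 \<le> n \<Longrightarrow>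
      measure noise {s. real n * (c - m) \<le> \<bar>boundary_lpp n z k s - real n * head_sum a b k z\<bar>} \<le> 4 * exp (- (\<kappa> * real n))"
    using boundary_lpp_deviation[OF z(1,2) m(2,3) mc] by metis
  define A where "A n k = {s. (\<forall>e. 0 \<le> s e) \<and> real n * c < lpp (bulk_weight n s) (n * k) (n * k)}" for n k
  have "{s \<in> space noise. (\<forall>e. 0 \<le> s e) \<and> real n * c < lpp (bulk_weight n s) (n * k) (n * k)} \<in> sets noise" for n k
    by measurable
  then have A: "A n k \<in> sets noise" for n k by (simp add: A_def)
  have A_le: "measure noise (A n k) \<le> 4 * exp (- (\<kappa> * real n))" if n: "1 \<le> n" for n k
  proof -
    have "A n k \<subseteq> {s. real n * (c - m) \<le> \<bar>boundary_lpp n z k s - real n * head_sum a b k z\<bar>}"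
    proof
      fix s assume s: "s \<in> A n k"
      then have "real n * c < boundary_lpp n z k s"
        using bulk_le_boundary_lpp[OF z(1,2), of s n k] by (auto simp: A_def)
      moreover have "real n * head_sum a b k z \<le> real n * m" by (intro mult_left_mono m) simp
      ultimately show "s \<in> {s. real n * (c - m) \<le> \<bar>boundary_lpp n z k s - real n * head_sum a b k z\<bar>}"
        by (simp add: right_diff_distrib)
    qed
    moreover have "{s \<in> space noise. real n * (c - m) \<le> \<bar>boundary_lpp n z k s - real n * head_sum a b k z\<bar>} \<in> sets noise"
      by measurable
    ultimately have "measure noise (A n k) \<le> measure noise {s. real n * (c - m) \<le> \<bar>boundary_lpp n z k s - real n * head_sum a b k z\<bar>}"
      by (intro finite_measure_mono) auto
    with \<kappa>(2)[OF n, of k] show ?thesis by linarith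
  qed
  have "AE s in noise. eventually (\<lambda>n. \<not> (\<exists>k. s \<in> A n k)) sequentially"
  proof (rule AE_noise_eventually[OF _ \<kappa>(1)])
    have eq: "{s. \<exists>k. s \<in> A n k} = (\<Union>k. A n k)" for n by auto
    show "{s. \<exists>k. s \<in> A n k} \<in> sets noise" for n unfolding eq using A by auto
    fix n :: nat assume n: "1 \<le> n"
    have "incseq (A n)"
    proof (rule incseq_SucI)
      fix k
      have mono: "lpp (bulk_weight n s) (n * k) (n * k) \<le> lpp (bulk_weight n s) (n * Suc k) (n * Suc k)"
        if "\<forall>e. 0 \<le> s e" for s
        using that by (intro lpp_mono bulk_weight_nonneg) auto
      show "A n k \<subseteq> A n (Suc k)"
        unfolding A_def using mono by (blast intro: less_le_trans)
    qed
    then have "(\<lambda>k. measure noise (A n k)) \<longlonglongrightarrow> measure noise (\<Union>k. A n k)"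
      using A by (intro finite_Lim_measure_incseq) auto
    then show "measure noise {s. \<exists>k. s \<in> A n k} \<le> 4 * exp (- (\<kappa> * real n))"
      unfolding eq by (rule LIMSEQ_le_const2) (use A_le[OF n] in auto)
  qed
  with AE_noise_nonneg show ?thesis
  proof eventually_elim
    case (elim s)
    from elim(2) eventually_gt_at_top[of 0] show ?case
    proof eventually_elim
      case (elim n)
      have "lpp (bulk_weight n s) i j \<le> real n * c" for i j
      proof -
        have "i \<le> n * max i j" "j \<le> n * max i j"
          using elim(2) by (metis Suc_leI mult_le_mono max.cobounded1 max.cobounded2 One_nat_def mult_1)+
        then have "lpp (bulk_weight n s) i j \<le> lpp (bulk_weight n s) (n * max i j) (n * max i j)"
          using \<open>\<forall>e. 0 \<le> s e\<close> by (intro lpp_mono bulk_weight_nonneg) auto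
        also have "\<dots> \<le> real n * c"
          using elim(1) \<open>\<forall>e. 0 \<le> s e\<close> by (auto simp: A_def not_less)
        finally show ?thesis .
      qed
      then show ?case by blast
    qed
  qed
qed

text \<open>The number \<open>n div r\<close> of boundary steps is a fixed fraction \<open>\<epsilon> = 1 / r\<close> of \<open>n\<close>.\<close>

lemma AE_axis_sum_tendsto:
  assumes e: "inj e"
  shows "AE s in noise. (\<lambda>n. (\<Sum>i=1..n div r. s (e i)) / real n) \<longlonglongrightarrow> 1 / real r"
proof -
  have "AE s in noise. (\<lambda>n. ((\<Sum>i=1..n div r. s (e i)) - real (n div r)) / real n) \<longlonglongrightarrow> 0"
  proof (rule AE_noise_tendsto)
    fix \<delta> :: real assume \<delta>: "0 < \<delta>"
    have "measure noise {s. real n * \<delta> \<le> \<bar>(\<Sum>i=1..n div r. s (e i)) - real (n div r) - real n * 0\<bar>}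
        \<le> 2 * exp (- (min (1 / (2 * 1)) (\<delta> / (4 * 1\<^sup>2)) * \<delta> / 2 * real n))" for n
      using noise_family_deviation[of "{1..n div r}" e 1 \<delta> "\<lambda>_. 1" n] \<delta> inj_on_subset[OF e]
      by (simp add: div_le_dividend)
    moreover have "0 < min (1 / (2 * 1)) (\<delta> / (4 * 1\<^sup>2)) * \<delta> / 2" using \<delta> by simp
    ultimately show "\<exists>\<kappa>>0. \<exists>C. \<forall>n\<ge>1. measure noise {s. real n * \<delta> \<le> \<bar>(\<Sum>i=1..n div r. s (e i)) - real (n div r) - real n * 0\<bar>}
        \<le> C * exp (- (\<kappa> * real n))"
      by blast
  qed measurable
  then show ?thesis
  proof eventually_elim
    case (elim s)
    have "(\<lambda>n. real (n div r) / real n) \<longlonglongrightarrow> 1 / real r"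
    proof (cases "r = 0")
      case False
      have "(\<lambda>n. 1 / real r - real (n mod r) / real r / real n) \<longlonglongrightarrow> 1 / real r - 0"
      proof (intro tendsto_intros)
        show "(\<lambda>n. real (n mod r) / real r / real n) \<longlonglongrightarrow> 0"
        proof (rule Lim_null_comparison)
          show "eventually (\<lambda>n. norm (real (n mod r) / real r / real n) \<le> 1 / real n) sequentially"
            using False by (intro always_eventually allI) (auto simp: divide_simps less_imp_le)
          show "(\<lambda>n. 1 / real n) \<longlonglongrightarrow> 0" by (rule lim_1_over_n)
        qed
      qed
      moreover have "1 / real r - real (n mod r) / real r / real n = real (n div r) / real n" if "0 < n" for n
      proof -
        have "real n = real (n div r) * real r + real (n mod r)"
          by (metis div_mult_mod_eq of_nat_add of_nat_mult)
        then have "real (n div r) = real n / real r - real (n mod r) / real r"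
          using False by (simp add: field_simps)
        then show ?thesis using that by (simp add: diff_divide_distrib)
      qed
      then have "eventually (\<lambda>n. 1 / real r - real (n mod r) / real r / real n = real (n div r) / real n) sequentially"
        by (rule eventually_mono[OF eventually_gt_at_top[of 0]])
      ultimately show ?thesis by (simp add: tendsto_cong)
    qed simp
    from tendsto_add[OF elim this] show ?case
      by (simp add: diff_divide_distrib)
  qed
qed

text \<open>The first \<open>K \<le> n\<close> steps of either axis stay in the first block, so the axis sums are multiples of
  \<open>U\<close> and \<open>V\<close> with the rates \<open>a 1\<close> and \<open>b 1\<close>.\<close>

lemma boundary_lpp_exit_bound:
  assumes z: "p < z" "z < q" and \<eta>: "0 < \<eta>\<^sub>1" "p < z - \<eta>\<^sub>1" "0 < \<eta>\<^sub>2" "z + \<eta>\<^sub>2 < q"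
    and s: "\<And>e. 0 \<le> s e" and K: "0 < n" "K \<le> n"
  defines "U \<equiv> \<Sum>i=1..K. s (i, 0)" and "V \<equiv> \<Sum>j=1..K. s (0, j)"
  shows "boundary_lpp n z k s \<le> max (U / (a 1 + z) + V / (b 1 - z) + lpp (bulk_weight n s) (n * k) (n * k))
    (max (boundary_lpp n (z - \<eta>\<^sub>1) k s - U * (1 / (a 1 + (z - \<eta>\<^sub>1)) - 1 / (a 1 + z)))
      (boundary_lpp n (z + \<eta>\<^sub>2) k s - V * (1 / (b 1 - (z + \<eta>\<^sub>2)) - 1 / (b 1 - z))))"
proof -
  let ?w = "\<lambda>z. stat_weight (\<lambda>i. a (block n i) + z) (\<lambda>j. b (block n j) - z) s"
  have first: "block n i = 1" if "i \<in> {1..K}" for i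
    using that K by (intro block_eq_1) auto
  have mono: "?w z i 0 \<le> ?w (z - \<eta>\<^sub>1) i 0" "?w z 0 i \<le> ?w (z + \<eta>\<^sub>2) 0 i" if "1 \<le> i" for i
    using that s rate_pos[OF z block_ge_1[of n i]] rate_pos[OF \<eta>(2) _ block_ge_1[of n i]] rate_pos[OF _ \<eta>(4) block_ge_1[of n i]] z \<eta>
    by (auto simp: stat_weight_def intro!: divide_left_mono mult_pos_pos)
  have "lpp (?w z) (n * k) (n * k) \<le> max ((\<Sum>i=1..K. ?w z i 0) + (\<Sum>j=1..K. ?w z 0 j) + lpp (off_axes (?w z)) (n * k) (n * k))
    (max (lpp (?w (z - \<eta>\<^sub>1)) (n * k) (n * k) - (\<Sum>i=1..K. ?w (z - \<eta>\<^sub>1) i 0 - ?w z i 0))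
      (lpp (?w (z + \<eta>\<^sub>2)) (n * k) (n * k) - (\<Sum>j=1..K. ?w (z + \<eta>\<^sub>2) 0 j - ?w z 0 j)))"
  proof (rule lpp_exit_bound)
    show "0 \<le> ?w z i 0" "0 \<le> ?w z 0 i" for i
      by (rule stat_weight_nonneg[OF z s])+
    show "?w (z - \<eta>\<^sub>1) (Suc i) (Suc j) = ?w z (Suc i) (Suc j)"
      "?w (z + \<eta>\<^sub>2) (Suc i) (Suc j) = ?w z (Suc i) (Suc j)" for i j
      by (simp_all add: stat_weight_def)
  qed (fact mono)+
  moreover have "(\<Sum>i=1..K. ?w y i 0) = U / (a 1 + y)" "(\<Sum>j=1..K. ?w y 0 j) = V / (b 1 - y)" for y
    unfolding U_def V_def sum_divide_distrib
    by (intro sum.cong refl; use first in \<open>auto simp: stat_weight_def\<close>)+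
  ultimately show ?thesis
    unfolding boundary_lpp_def off_axes_stat_weight by (simp add: sum_subtractf right_diff_distrib)
qed

text \<open>Divide the exit bound by \<open>n\<close>. By the choice of the shifts, the last two terms of the maximum have limits
  strictly below that of the left-hand side, so eventually the first term, which contains the bulk, is the
  largest.\<close>

lemma AE_bulk_lower:
  assumes c: "ereal c < M_inf a b"
  shows "AE s in noise. eventually (\<lambda>n. \<exists>i\<ge>1. real n * c < lpp (bulk_weight n s) i i) sequentially"
proof -
  obtain k z where z: "p < z" "z < q" "c < head_sum a b k z"
    "\<And>y. p < y \<Longrightarrow> y < q \<Longrightarrow> head_sum a b k z \<le> head_sum a b k y"
    using large_minimum[OF c] by metis
  have r1: "0 < 1 / (a 1 + z) + 1 / (b 1 - z)" (is "0 < ?R")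
    using rate_pos[OF z(1,2), of 1] by (auto intro: add_pos_pos)
  \<comment> \<open>A fraction \<open>1 / r\<close> of the first block, small enough for the weight collected on it to fit into the gap between \<open>c\<close> and the minimum.\<close>
  obtain r :: nat where r: "0 < r" "?R / (head_sum a b k z - c) < real r"
    using reals_Archimedean2[of "max 1 (?R / (head_sum a b k z - c))"] by (metis max_less_iff_conj of_nat_0_less_iff less_trans zero_less_one)
  define \<epsilon> where "\<epsilon> = 1 / real r"
  have \<epsilon>: "0 < \<epsilon>" using r by (simp add: \<epsilon>_def)
  have \<epsilon>c: "c < head_sum a b k z - \<epsilon> / (a 1 + z) - \<epsilon> / (b 1 - z)"
  proof -
    have "?R < real r * (head_sum a b k z - c)" using r z(3) by (simp add: pos_divide_less_eq)
    then have "?R / real r < head_sum a b k z - c" using r by (simp add: pos_divide_less_eq mult.commute)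
    then show ?thesis by (simp add: \<epsilon>_def add_divide_distrib mult.commute)
  qed
  obtain \<eta>\<^sub>1 \<eta>\<^sub>2 where \<eta>: "0 < \<eta>\<^sub>1" "p < z - \<eta>\<^sub>1" "0 < \<eta>\<^sub>2" "z + \<eta>\<^sub>2 < q"
    and gain: "head_sum a b k (z - \<eta>\<^sub>1) - \<epsilon> * (1 / (a 1 + (z - \<eta>\<^sub>1)) - 1 / (a 1 + z)) < head_sum a b k z"
      "head_sum a b k (z + \<eta>\<^sub>2) - \<epsilon> * (1 / (b 1 - (z + \<eta>\<^sub>2)) - 1 / (b 1 - z)) < head_sum a b k z"
    using perturbations_at_minimum[OF z(1,2) z(4) \<epsilon>] by metis
  let ?U = "\<lambda>n s. \<Sum>i=1..n div r. s (i, 0)" and ?V = "\<lambda>n s. \<Sum>j=1..n div r. s (0, j)"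
  have "AE s in noise. (\<lambda>n. ?U n s / real n) \<longlonglongrightarrow> \<epsilon>" "AE s in noise. (\<lambda>n. ?V n s / real n) \<longlonglongrightarrow> \<epsilon>"
    unfolding \<epsilon>_def by (intro AE_axis_sum_tendsto injI; simp)+
  moreover have "AE s in noise. (\<lambda>n. boundary_lpp n z k s / real n) \<longlonglongrightarrow> head_sum a b k z"
    "AE s in noise. (\<lambda>n. boundary_lpp n (z - \<eta>\<^sub>1) k s / real n) \<longlonglongrightarrow> head_sum a b k (z - \<eta>\<^sub>1)"
    "AE s in noise. (\<lambda>n. boundary_lpp n (z + \<eta>\<^sub>2) k s / real n) \<longlonglongrightarrow> head_sum a b k (z + \<eta>\<^sub>2)"
    using z \<eta> by (auto intro!: AE_boundary_lpp_tendsto)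
  ultimately show ?thesis
    using AE_noise_nonneg
  proof eventually_elim
    case (elim s)
    let ?L = "\<lambda>y n. boundary_lpp n y k s / real n" and ?u = "\<lambda>n. ?U n s / real n" and ?v = "\<lambda>n. ?V n s / real n"
    let ?d1 = "1 / (a 1 + (z - \<eta>\<^sub>1)) - 1 / (a 1 + z)" and ?d2 = "1 / (b 1 - (z + \<eta>\<^sub>2)) - 1 / (b 1 - z)"
    have ab: "a 1 + z \<noteq> 0" "b 1 - z \<noteq> 0" using rate_pos[OF z(1,2), of 1] by auto
    have "(\<lambda>n. ?L z n - ?u n / (a 1 + z) - ?v n / (b 1 - z)) \<longlonglongrightarrow> head_sum a b k z - \<epsilon> / (a 1 + z) - \<epsilon> / (b 1 - z)"
      by (intro tendsto_intros elim ab)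
    from order_tendstoD(1)[OF this \<epsilon>c]
    have bulk: "eventually (\<lambda>n. c < ?L z n - ?u n / (a 1 + z) - ?v n / (b 1 - z)) sequentially" .
    have "(\<lambda>n. ?L z n - (?L (z - \<eta>\<^sub>1) n - ?u n * ?d1)) \<longlonglongrightarrow> head_sum a b k z - (head_sum a b k (z - \<eta>\<^sub>1) - \<epsilon> * ?d1)"
      by (rule tendsto_diff[OF elim(3) tendsto_diff[OF elim(4) tendsto_mult_right[OF elim(1)]]])
    from order_tendstoD(1)[OF this, of 0] gain
    have no_first: "eventually (\<lambda>n. 0 < ?L z n - (?L (z - \<eta>\<^sub>1) n - ?u n * ?d1)) sequentially" by simp
    have "(\<lambda>n. ?L z n - (?L (z + \<eta>\<^sub>2) n - ?v n * ?d2)) \<longlonglongrightarrow> head_sum a b k z - (head_sum a b k (z + \<eta>\<^sub>2) - \<epsilon> * ?d2)"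
      by (rule tendsto_diff[OF elim(3) tendsto_diff[OF elim(5) tendsto_mult_right[OF elim(2)]]])
    from order_tendstoD(1)[OF this, of 0] gain
    have no_second: "eventually (\<lambda>n. 0 < ?L z n - (?L (z + \<eta>\<^sub>2) n - ?v n * ?d2)) sequentially" by simp
    show ?case
      using bulk no_first no_second eventually_gt_at_top[of 0]
    proof eventually_elim
      case (elim n)
      note n = elim(4)
      have scale: "x < y" if "0 < y / real n - x / real n" for x y
        using that n by (simp add: diff_divide_distrib[symmetric] zero_less_divide_iff)
      have "boundary_lpp n (z - \<eta>\<^sub>1) k s - ?U n s * ?d1 < boundary_lpp n z k s"
        by (rule scale) (use elim(2) in \<open>simp add: diff_divide_distrib\<close>)
      moreover have "boundary_lpp n (z + \<eta>\<^sub>2) k s - ?V n s * ?d2 < boundary_lpp n z k s"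
        by (rule scale) (use elim(3) in \<open>simp add: diff_divide_distrib\<close>)
      ultimately have "boundary_lpp n z k s \<le> ?U n s / (a 1 + z) + ?V n s / (b 1 - z) + lpp (bulk_weight n s) (n * k) (n * k)"
        using boundary_lpp_exit_bound[OF z(1,2) \<eta>, of s n "n div r" k] n \<open>\<forall>e. 0 \<le> s e\<close>
        by (auto simp: max_def split: if_splits)
      moreover have "real n * c < boundary_lpp n z k s - ?U n s / (a 1 + z) - ?V n s / (b 1 - z)"
      proof -
        have "c < (boundary_lpp n z k s - ?U n s / (a 1 + z) - ?V n s / (b 1 - z)) / real n"
          using elim(1) by (simp add: diff_divide_distrib mult.commute)
        then show ?thesis using n by (simp add: pos_less_divide_eq mult.commute)
      qed
      moreover have "lpp (bulk_weight n s) (n * k) (n * k) \<le> lpp (bulk_weight n s) (Suc (n * k)) (Suc (n * k))"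
        using \<open>\<forall>e. 0 \<le> s e\<close> by (intro lpp_mono bulk_weight_nonneg) auto
      ultimately have "real n * c < lpp (bulk_weight n s) (Suc (n * k)) (Suc (n * k))" by linarith
      then show ?case by (intro exI[of _ "Suc (n * k)"]) simp
    qed
  qed
qed

end

section \<open>The limit\<close>

context summable_rates
begin

definition scaled_sup :: "nat \<Rightarrow> (nat \<times> nat \<Rightarrow> real) \<Rightarrow> ereal" where
  "scaled_sup n s = ereal (inverse (real n)) * (SUP (i, j)\<in>{1..} \<times> {1..}. ereal (lpp (bulk_weight n s) i j))"

lemma scaled_sup_le:
  assumes n: "0 < n" and le: "\<And>i j. lpp (bulk_weight n s) i j \<le> real n * c"
  shows "scaled_sup n s \<le> ereal c"
proof -
  have "scaled_sup n s \<le> ereal (inverse (real n)) * ereal (real n * c)"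
    unfolding scaled_sup_def using le by (intro ereal_mult_left_mono SUP_least) auto
  also have "\<dots> = ereal c" using n by simp
  finally show ?thesis .
qed

lemma scaled_sup_ge:
  assumes n: "0 < n" and i: "1 \<le> i" and le: "real n * c \<le> lpp (bulk_weight n s) i i"
  shows "ereal c \<le> scaled_sup n s"
proof -
  have "ereal c = ereal (inverse (real n)) * ereal (real n * c)" using n by simp
  also have "\<dots> \<le> scaled_sup n s"
    unfolding scaled_sup_def
    using i le by (intro ereal_mult_left_mono SUP_upper2[where i = "(i, i)"]) auto
  finally show ?thesis .
qed

text \<open>Rational levels suffice, and countably many null sets can be discarded together.\<close>

lemma AE_noise_scaled_sup: "AE s in noise. (\<lambda>n. scaled_sup n s) \<longlonglongrightarrow> M_inf a b"
proof -
  have "AE s in noise. \<forall>r::rat.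
    (M_inf a b < ereal (of_rat r) \<longrightarrow> eventually (\<lambda>n. scaled_sup n s \<le> ereal (of_rat r)) sequentially) \<and>
    (ereal (of_rat r) < M_inf a b \<longrightarrow> eventually (\<lambda>n. ereal (of_rat r) \<le> scaled_sup n s) sequentially)"
    unfolding AE_all_countable
  proof
    fix r :: rat
    consider "M_inf a b < ereal (of_rat r)" | "M_inf a b = ereal (of_rat r)" | "ereal (of_rat r) < M_inf a b"
      by (rule linorder_cases)
    then show "AE s in noise.
      (M_inf a b < ereal (of_rat r) \<longrightarrow> eventually (\<lambda>n. scaled_sup n s \<le> ereal (of_rat r)) sequentially) \<and>
      (ereal (of_rat r) < M_inf a b \<longrightarrow> eventually (\<lambda>n. ereal (of_rat r) \<le> scaled_sup n s) sequentially)"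
    proof cases
      case 1
      from AE_bulk_upper[OF this] show ?thesis
      proof eventually_elim
        case (elim s)
        have "eventually (\<lambda>n. scaled_sup n s \<le> ereal (of_rat r)) sequentially"
          using elim eventually_gt_at_top[of 0] by eventually_elim (auto intro: scaled_sup_le)
        with 1 show ?case by auto
      qed
    next
      case 3
      from AE_bulk_lower[OF this] show ?thesis
      proof eventually_elim
        case (elim s)
        have "eventually (\<lambda>n. ereal (of_rat r) \<le> scaled_sup n s) sequentially"
          using elim eventually_gt_at_top[of 0]
          by eventually_elim (auto intro: scaled_sup_ge less_imp_le)
        with 3 show ?case by auto
      qed
    qed simp
  qed
  then show ?thesis
  proof eventually_elim
    case (elim s)
    show ?case
    proof (rule order_tendstoI)
      fix y assume "y < M_inf a b"
      then obtain r where r: "y < ereal (of_rat r)" "ereal (of_rat r) < M_inf a b"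
        using ereal_dense3 by blast
      then have "eventually (\<lambda>n. ereal (of_rat r) \<le> scaled_sup n s) sequentially"
        using elim by blast
      then show "eventually (\<lambda>n. y < scaled_sup n s) sequentially"
        by eventually_elim (use r in auto)
    next
      fix y assume "M_inf a b < y"
      then obtain r where r: "M_inf a b < ereal (of_rat r)" "ereal (of_rat r) < y"
        using ereal_dense3 by blast
      then have "eventually (\<lambda>n. scaled_sup n s \<le> ereal (of_rat r)) sequentially"
        using elim by blast
      then show "eventually (\<lambda>n. scaled_sup n s < y) sequentially"
        by eventually_elim (use r in auto)
    qed
  qed
qed

lemma scaled_sup_restrict: "scaled_sup n (restrict s ({1..} \<times> {1..})) = scaled_sup n s"
proof -
  have "bulk_weight n (restrict s ({1..} \<times> {1..})) = bulk_weight n s"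
    by (auto simp: bulk_weight_def off_axes_def fun_eq_iff)
  then show ?thesis by (simp add: scaled_sup_def)
qed

lemma borel_measurable_scaled_sup:
  "scaled_sup n \<in> borel_measurable (\<Pi>\<^sub>M _\<in>{1..} \<times> {1..}. borel)"
proof -
  have [measurable]: "(\<lambda>s. bulk_weight n s i j) \<in> borel_measurable (\<Pi>\<^sub>M _\<in>{1..} \<times> {1..}. borel)" for i j
    by (cases "i = 0 \<or> j = 0") (auto simp: bulk_weight_def off_axes_def)
  have lpp: "(\<lambda>s. lpp (bulk_weight n s) i j) \<in> borel_measurable (\<Pi>\<^sub>M _\<in>{1..} \<times> {1..}. borel)" for i j
    by (rule borel_measurable_lpp) measurable
  have "(\<lambda>s. SUP e\<in>{1..} \<times> {1..}. ereal (lpp (bulk_weight n s) (fst e) (snd e)))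
    \<in> borel_measurable (\<Pi>\<^sub>M _\<in>{1..} \<times> {1..}. borel)"
    by (intro borel_measurable_SUP borel_measurable_ereal lpp countableI_type)
  then show ?thesis
    unfolding scaled_sup_def[abs_def] by (simp add: case_prod_beta')
qed

text \<open>Forgetting the axis coordinates is a passage to an image measure, for which the limit event has to be
  measurable. It is, when the limit is expressed by lower and upper limits.\<close>

lemma AE_PiM_scaled_sup:
  "AE t in (\<Pi>\<^sub>M _\<in>{1..} \<times> {1..}. exp_distr 1). (\<lambda>n. scaled_sup n t) \<longlonglongrightarrow> M_inf a b"
proof -
  let ?I = "{1..} \<times> {1..} :: (nat \<times> nat) set"
  let ?E = "\<Pi>\<^sub>M _\<in>?I. exp_distr 1"
  have sets: "sets ?E = sets (\<Pi>\<^sub>M _\<in>?I. borel)" by (intro sets_PiM_cong) auto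
  have [measurable]: "scaled_sup n \<in> borel_measurable ?E" for n
    using borel_measurable_scaled_sup unfolding measurable_cong_sets[OF sets refl] .
  have conv: "(\<lambda>n. scaled_sup n t) \<longlonglongrightarrow> M_inf a b \<longleftrightarrow>
      liminf (\<lambda>n. scaled_sup n t) = M_inf a b \<and> limsup (\<lambda>n. scaled_sup n t) = M_inf a b" for t
    by (simp add: tendsto_iff_Liminf_eq_Limsup)
  have meas: "{t \<in> space ?E. (\<lambda>n. scaled_sup n t) \<longlonglongrightarrow> M_inf a b} \<in> sets ?E"
    unfolding conv by measurable
  have restrict: "(\<lambda>s. restrict s ?I) \<in> noise \<rightarrow>\<^sub>M ?E"
    unfolding noise_def by (rule measurable_restrict_subset) simp
  have "distr noise ?E (\<lambda>s. restrict s ?I) = ?E"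
    using distr_PiM_reindex[of UNIV "\<lambda>_. exp_distr 1" "\<lambda>e. e" ?I]
    by (simp add: noise_def prob_space_exponential_density restrict_def)
  moreover have "AE t in distr noise ?E (\<lambda>s. restrict s ?I). (\<lambda>n. scaled_sup n t) \<longlonglongrightarrow> M_inf a b"
    unfolding AE_distr_iff[OF restrict meas] scaled_sup_restrict by (rule AE_noise_scaled_sup)
  ultimately show ?thesis by (simp only:)
qed

lemma scaled_sup_eq_last_passage:
  assumes n: "0 < n" and nonneg: "\<And>i j. 1 \<le> i \<Longrightarrow> 1 \<le> j \<Longrightarrow> 0 \<le> w i j"
  shows "scaled_sup n (\<lambda>(i, j). w i j) = ereal (inverse (real n)) *
    (SUP (i, j)\<in>{1..} \<times> {1..}. ereal (last_passage (scaled_weight a b w n) i j))"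
proof -
  have weight: "scaled_weight a b w n i j = w i j / (a (block n i) + b (block n j))" if "1 \<le> i" "1 \<le> j" for i j
    using that by (simp only: scaled_weight_def nat_ceiling_eq_block[OF n])
  have bulk: "off_axes (scaled_weight a b w n) = bulk_weight n (\<lambda>(i, j). w i j)"
    by (auto simp: bulk_weight_def off_axes_def weight fun_eq_iff)
  have "last_passage (scaled_weight a b w n) i j = lpp (bulk_weight n (\<lambda>(i, j). w i j)) i j" if "1 \<le> i" "1 \<le> j" for i j
    unfolding bulk[symmetric]
  proof (rule last_passage_eq_lpp[OF _ that])
    fix i j :: nat assume ij: "1 \<le> i" "1 \<le> j"
    show "0 \<le> scaled_weight a b w n i j"
      unfolding weight[OF ij] using nonneg[OF ij] sum_rate_pos[OF block_ge_1[of n i] block_ge_1[of n j]] by simp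
  qed
  then show ?thesis
    unfolding scaled_sup_def by (intro arg_cong2[where f = "(*)"] SUP_cong refl) auto
qed

end

lemma inf_seq_real:
  assumes "0 < inf_seq a + inf_seq b"
  obtains p q where "inf_seq a = ereal (- p)" "inf_seq b = ereal q" "p < q"
proof -
  have "inf_seq a \<le> ereal (a 1)" "inf_seq b \<le> ereal (b 1)"
    unfolding inf_seq_def by (intro INF_lower; simp)+
  then show ?thesis
    using assms that[of "- real_of_ereal (inf_seq a)" "real_of_ereal (inf_seq b)"]
    by (cases "inf_seq a"; cases "inf_seq b") auto
qed

theorem theorem3p4:
  fixes a b :: "nat \<Rightarrow> real"
    and P :: "'w measure"
    and \<omega> :: "nat \<Rightarrow> nat \<Rightarrow> 'w \<Rightarrow> real"
  assumes inf_pos: "inf_seq a + inf_seq b > 0"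
    and M_finite: "\<And>z. - inf_seq a < ereal z \<Longrightarrow> ereal z < inf_seq b \<Longrightarrow> M_z a b z < \<infinity>"
    and P: "prob_space P"
    and indep: "prob_space.indep_vars P (\<lambda>_. borel) (\<lambda>(i, j). \<omega> i j) ({1..} \<times> {1..})"
    and exp1: "\<And>i j. i \<ge> 1 \<Longrightarrow> j \<ge> 1 \<Longrightarrow> distributed P lborel (\<omega> i j) (exponential_density 1)"
  shows "AE x in P.
    (\<lambda>n. ereal (inverse (real n)) *
          (SUP (i, j)\<in>{1..} \<times> {1..}.
             ereal (last_passage (scaled_weight a b (\<lambda>k l. \<omega> k l x) n) i j)))
      \<longlonglongrightarrow> M_inf a b"
proof -
  interpret prob_space P by (rule P)
  let ?I = "{1..} \<times> {1..} :: (nat \<times> nat) set"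
  let ?\<omega> = "\<lambda>(i, j). \<omega> i j"
  obtain p q where pq: "inf_seq a = ereal (- p)" "inf_seq b = ereal q" "p < q"
    using inf_seq_real[OF inf_pos] .
  interpret summable_rates a b p q
    by standard (use pq M_finite in auto)
  have rv: "random_variable borel (?\<omega> e)" if "e \<in> ?I" for e
  proof -
    have "distributed P lborel (?\<omega> e) (exponential_density 1)" using that exp1 by auto
    then have "?\<omega> e \<in> P \<rightarrow>\<^sub>M lborel" by (rule distributed_measurable)
    then show ?thesis by simp
  qed
  have law: "distr P borel (?\<omega> e) = exp_distr 1" if "e \<in> ?I" for e
  proof -
    have "distributed P lborel (?\<omega> e) (exponential_density 1)" using that exp1 by auto
    then have "distr P lborel (?\<omega> e) = exp_distr 1" by (rule distributed_distr_eq_density)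
    moreover have "distr P borel (?\<omega> e) = distr P lborel (?\<omega> e)" by (rule distr_cong) auto
    ultimately show ?thesis by simp
  qed
  have "distr P (\<Pi>\<^sub>M _\<in>?I. borel) (\<lambda>x. \<lambda>e\<in>?I. ?\<omega> e x) = (\<Pi>\<^sub>M e\<in>?I. distr P borel (?\<omega> e))"
    using indep_vars_iff_distr_eq_PiM'[of ?I ?\<omega> "\<lambda>_. borel"] rv indep by auto
  also have "\<dots> = (\<Pi>\<^sub>M _\<in>?I. exp_distr 1)"
    by (intro PiM_cong law) auto
  finally have joint: "distr P (\<Pi>\<^sub>M _\<in>?I. borel) (\<lambda>x. \<lambda>e\<in>?I. ?\<omega> e x) = (\<Pi>\<^sub>M _\<in>?I. exp_distr 1)" .
  have "AE x in P. (\<lambda>n. scaled_sup n (\<lambda>e\<in>?I. ?\<omega> e x)) \<longlonglongrightarrow> M_inf a b"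
    using AE_PiM_scaled_sup unfolding joint[symmetric]
    by (rule AE_distrD[rotated]) (intro measurable_restrict rv)
  \<comment> \<open>Nonnegativity of the weights identifies the recursion with the maximum over paths.\<close>
  moreover have "AE x in P. \<forall>e\<in>?I. 0 \<le> ?\<omega> e x"
    unfolding AE_ball_countable[OF countable_subset[OF subset_UNIV countableI_type]]
  proof
    fix e assume e: "e \<in> ?I"
    have "AE y in exp_distr 1. 0 \<le> y"
      by (subst AE_density) (auto simp: exponential_density_def)
    then show "AE x in P. 0 \<le> ?\<omega> e x"
      unfolding law[OF e, symmetric] by (rule AE_distrD[OF rv[OF e]])
  qed
  ultimately show ?thesis
  proof eventually_elim
    case (elim x)
    have "eventually (\<lambda>n. scaled_sup n (\<lambda>e\<in>?I. ?\<omega> e x) = ereal (inverse (real n)) *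
      (SUP (i, j)\<in>?I. ereal (last_passage (scaled_weight a b (\<lambda>k l. \<omega> k l x) n) i j))) sequentially"
      using eventually_gt_at_top[of 0]
    proof eventually_elim
      case n: (elim n)
      have "scaled_sup n (\<lambda>e\<in>?I. ?\<omega> e x) = scaled_sup n (\<lambda>(i, j). \<omega> i j x)"
        by (subst scaled_sup_restrict) (simp add: case_prod_beta')
      then show ?case
        using scaled_sup_eq_last_passage[OF n, of "\<lambda>i j. \<omega> i j x"] elim(2) by auto
    qed
    with elim(1) show ?case
      by (rule Lim_transform_eventually)
  qed
qed

end
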